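(* Let $n \geqslant 4$ be an integer, and let $s = [n\ \ n-1\ \dots\ 1]$ and $r = [2\ 3\ \dots\ n\ 1]$ be elements of $S_n$ in one-line notation. Then for every $i \in \{1,2,\dots,n\}$, $$ \mathrm{dist}(sr^{n-i},()) = \left\lceil\frac{n}{2}\right\rceil \left(\left\lceil\frac{n}{2}\right\rceil-1\right)-1 + \left\lfloor\frac{n}{2}\right\rfloor\left(\left\lfloor\frac{n}{2}\right\rfloor-1\right)-1 + \begin{cases} \left\lfloor\frac{n}{2}\right\rfloor + 1, & i=1,\\ \left\lfloor\frac{n}{2}\right\rfloor - i + 4, & 2 \le i \le \left\lfloor\frac{n}{2}\right\rfloor+2,\\ i - \left\lceil\frac{n}{2}\right\rceil, & \left\lceil\frac{n}{2}\right\rceil+2 \le i \le n. \end{cases} $$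
   Context: $S_n$ is the group of permutations of $\{1,\dots,n\}$, with identity element $()$. Square brackets denote one-line notation: $\pi = [\pi_1\ \pi_2\ \dots\ \pi_n]$ means $\pi(k)=\pi_k$. Products are composed so that $(\pi\tau)(k) = \pi(\tau(k))$; thus right multiplication acts on positions. With $r = [2\ 3\ \dots\ n\ 1] = (1\,2\,\dots\,n)$ one has $\pi r = [\pi_2\ \pi_3\ \dots\ \pi_n\ \pi_1]$ (left shift), and $r^{-1} = (1\,n\,\dots\,2)$ is the right shift. Let $\delta = (1\,2) = [2\ 1\ 3\ \dots\ n]$, so $\pi\delta = [\pi_2\ \pi_1\ \pi_3\ \dots\ \pi_n]$. Let $\Gamma$ be the Cayley graph of $S_n$ with generators $\delta, r, r^{-1}$: its vertex set is $S_n$, and its edge set is $\{\{g,h\} : g,h\in S_n,\ g^{-1}h \in \{\delta, r, r^{-1}\}\}$. All edges have weight one. $\mathrm{dist}(\pi',\pi'')$ denotes the length of a shortest path in $\Gamma$ between $\pi'$ and $\pi''$. *)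

theory Defs
  imports Complex_Main "HOL-Combinatorics.Combinatorics"
begin

text \<open>
  An undirected graph is given by a vertex set \<open>V\<close> and a set \<open>E\<close> of edges, each edge being a
  set of endpoints.  A path is represented by its nonempty list of vertices, so its length is
  the length of the list minus one.
\<close>

definition path_between :: "'a set \<Rightarrow> 'a set set \<Rightarrow> 'a \<Rightarrow> 'a list \<Rightarrow> 'a \<Rightarrow> bool" where
  "path_between V E u p v \<longleftrightarrow>
     p \<noteq> [] \<and> hd p = u \<and> last p = v \<and> set p \<subseteq> V \<and> distinct p \<and>
     successively (\<lambda>x y. {x, y} \<in> E) p"

text \<open>
  If \<open>u\<close> and \<open>v\<close> are not connected, this value is an unspecified natural number.
\<close>

definition graph_dist :: "'a set \<Rightarrow> 'a set set \<Rightarrow> 'a \<Rightarrow> 'a \<Rightarrow> nat" where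
  "graph_dist V E u v = (LEAST k. \<exists>p. path_between V E u p v \<and> k = length p - 1)"

text \<open>
  Elements of \<open>S\<^sub>n\<close> are functions on \<^typ>\<open>nat\<close> that permute \<open>{1..n}\<close> and fix everything
  else; the product \<open>\<pi>\<tau>\<close> is \<open>\<pi> \<circ> \<tau>\<close> and the identity is \<^const>\<open>id\<close>.
\<close>

definition sym_perms :: "nat \<Rightarrow> (nat \<Rightarrow> nat) set" where
  "sym_perms n = {\<pi>. \<pi> permutes {1..n}}"

text \<open>One-line notation; positions are counted from 1, list indices from 0.\<close>

definition one_line :: "nat list \<Rightarrow> nat \<Rightarrow> nat" where
  "one_line xs k = (if 1 \<le> k \<and> k \<le> length xs then xs ! (k - 1) else k)"

definition perm_s :: "nat \<Rightarrow> nat \<Rightarrow> nat" where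
  "perm_s n = one_line (rev [1..<n + 1])"

definition perm_r :: "nat \<Rightarrow> nat \<Rightarrow> nat" where
  "perm_r n = one_line ([2..<n + 1] @ [1])"

definition perm_delta :: "nat \<Rightarrow> nat" where
  "perm_delta = transpose 1 2"

definition cayley_edges :: "nat \<Rightarrow> (nat \<Rightarrow> nat) set set" where
  "cayley_edges n =
     {{g, h} | g h. g \<in> sym_perms n \<and> h \<in> sym_perms n \<and>
                    inv g \<circ> h \<in> {perm_delta, perm_r n, inv (perm_r n)}}"

definition cayley_dist :: "nat \<Rightarrow> (nat \<Rightarrow> nat) \<Rightarrow> (nat \<Rightarrow> nat) \<Rightarrow> nat" where
  "cayley_dist n = graph_dist (sym_perms n) (cayley_edges n)"

end

theory Submission
  imports Defs
begin

text \<open>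
  Consecutive elements \<open>s r\<^sup>n\<^sup>-\<^sup>i\<close> (cyclically in \<open>i\<close>) are adjacent, so their distances to the identity
  differ by at most one, and the formula has slope \<open>\<plusminus>1\<close> between its maximum at \<open>i = 2\<close> and its
  minima at \<open>i = \<lfloor>n/2\<rfloor> + 2\<close> and \<open>i = \<lceil>n/2\<rceil> + 2\<close>.  It therefore suffices to bound the distance
  below by \<open>n (n - 1) / 2\<close> at \<open>i = 2\<close> and above at the two minima.

  Upper bound: place the entries on a circle with a head between two of them.  Two arcs are reversed
  one after the other by a cocktail-shaker sort in which swaps and moves alternate; the first arc is
  processed from its middle to its end, the second from its end to its middle, and two further moves
  lead from one arc to the other.

  Lower bound at \<open>i = 2\<close>, where reading the circle from the head gives the reversed order.  Swaps
  and moves are bounded separately.  Swaps: let two entries be equivalent if they pass the head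
  equally often modulo 2; equivalent entries must be swapped with each other, and there are
  at most two classes.  Moves: identify the two places at the head, so that the head becomes a robot
  on a circle of \<open>N = n - 1\<close> sites which at each move carries exactly one item.  In suitable
  coordinates every item has to be taken to its mirror image about an axis.  Summing the shortest
  routes almost gives the bound; the rest comes from the fact that, whenever the robot reaches a new
  distance from the axis, the item it carries is dragged farther from the axis than it ever had to be.
\<close>

section \<open>Moving along a circle\<close>

text \<open>
  Positions are ranked from the head: \<open>2, 3, \<dots>, n, 1\<close> have ranks \<open>0, \<dots>, N\<close> with \<open>N = n - 1\<close>.
  The step \<open>0\<close> stands for \<open>\<delta>\<close>, the steps \<open>1\<close> and \<open>-1\<close> for \<open>r\<close> and its inverse.
\<close>

primrec rank_at :: "int \<Rightarrow> (nat \<Rightarrow> int) \<Rightarrow> nat \<Rightarrow> int \<Rightarrow> int" where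
  "rank_at N mv 0 b = b"
| "rank_at N mv (Suc t) b =
    (let x = rank_at N mv t b in
     if mv t = 0 then (if x = 0 then N else if x = N then 0 else x)
     else if mv t = 1 then (if x = 0 then N else x - 1)
     else (if x = N then 0 else x + 1))"

section \<open>Levels and routes to a mirror image\<close>

text \<open>Distance to the nearest multiple of \<open>2 * N\<close>. In doubled coordinates the
  circle has circumference \<open>2 * N\<close>, so this is the distance from one end of the axis;
  the other end has level \<open>N\<close>.\<close>

definition lev :: "int \<Rightarrow> int \<Rightarrow> int" where
  "lev N z = min (z mod (2 * N)) (2 * N - z mod (2 * N))"

lemma lev_bounds: "0 \<le> lev N z" "lev N z \<le> N" if "N > 0"
proof -
  have "0 \<le> z mod (2 * N)" "z mod (2 * N) < 2 * N" using that by auto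
  then show "0 \<le> lev N z" "lev N z \<le> N" unfolding lev_def by linarith+
qed

lemma lev_cong: "lev N z = lev N w" if "2 * N dvd z - w"
  using that unfolding lev_def by (metis mod_eq_dvd_iff)

lemma lev_le_dist: "lev N z \<le> \<bar>z - 2 * N * k\<bar>" if "N > 0"
proof -
  define q where "q = z div (2 * N) - k"
  have z: "z - 2 * N * k = 2 * N * q + z mod (2 * N)"
    unfolding q_def right_diff_distrib using mult_div_mod_eq[of "2 * N" z] by linarith
  have r: "0 \<le> z mod (2 * N)" "z mod (2 * N) < 2 * N" using that by auto
  show ?thesis
  proof (cases "q \<ge> 0")
    case True
    then have "0 \<le> 2 * N * q" using that by simp
    then show ?thesis unfolding lev_def using z r by linarith
  next
    case False
    then have "2 * N * q \<le> 2 * N * (-1)" using that by (intro mult_left_mono) auto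
    then show ?thesis unfolding lev_def using z r by linarith
  qed
qed

lemma lev_shift: "lev N (z + N) = N - lev N z" if "N > 0"
proof -
  define r where "r = z mod (2 * N)"
  have r: "0 \<le> r" "r < 2 * N" using that unfolding r_def by auto
  have e: "(z + N) mod (2 * N) = (r + N) mod (2 * N)" unfolding r_def by (simp add: mod_simps)
  show ?thesis
  proof (cases "r < N")
    case True
    then have "(r + N) mod (2 * N) = r + N" using r by simp
    then show ?thesis unfolding lev_def e r_def[symmetric] using True r by linarith
  next
    case False
    have "(r + N) mod (2 * N) = (r + N - 2 * N) mod (2 * N)" by (rule minus_mod_self2[symmetric])
    also have "r + N - 2 * N = r - N" by simp
    also have "(r - N) mod (2 * N) = r - N" using False r by (intro mod_pos_pos_trivial) auto
    finally show ?thesis unfolding lev_def e r_def[symmetric] using False r by linarith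
  qed
qed

text \<open>Twice the displacement of \<open>v\<close> or \<open>z\<close> from the midpoint is, up
  to sign, the difference or the sum of the two legs, so both claims are triangle
  inequalities.\<close>

lemma abs_midpoint:
  fixes m v z e :: int
  assumes "e + z = 2 * m"
  shows "2 * \<bar>v - m\<bar> \<le> \<bar>v - z\<bar> + \<bar>e - v\<bar>" and "2 * \<bar>z - m\<bar> \<le> \<bar>v - z\<bar> + \<bar>e - v\<bar>"
proof -
  have e: "e = 2 * m - z" using assms by simp
  have "2 * \<bar>v - m\<bar> = \<bar>2 * (v - m)\<bar>" by (simp only: abs_mult abs_numeral)
  also have "2 * (v - m) = (v - z) - (e - v)" unfolding e by simp
  finally have "2 * \<bar>v - m\<bar> = \<bar>(v - z) - (e - v)\<bar>" .
  then show "2 * \<bar>v - m\<bar> \<le> \<bar>v - z\<bar> + \<bar>e - v\<bar>" using abs_triangle_ineq4[of "v - z" "e - v"] by simp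
  have "2 * \<bar>z - m\<bar> = \<bar>2 * (z - m)\<bar>" by (simp only: abs_mult abs_numeral)
  also have "2 * (z - m) = - ((v - z) + (e - v))" unfolding e by simp
  finally have "2 * \<bar>z - m\<bar> = \<bar>(v - z) + (e - v)\<bar>" by simp
  then show "2 * \<bar>z - m\<bar> \<le> \<bar>v - z\<bar> + \<bar>e - v\<bar>" using abs_triangle_ineq[of "v - z" "e - v"] by simp
qed

text \<open>The lifted end points have midpoint \<open>N * k\<close>. For even \<open>k\<close> it
  lies over the axis end of level 0, at distance at least \<open>lev N v\<close> from
  \<open>v\<close>; for odd \<open>k\<close> it lies over the antipode, at distance at least
  \<open>N - lev N z\<close> from \<open>z\<close>.\<close>

lemma reflected_path_length:
  fixes N z v e :: int
  assumes "N > 0" and "2 * N dvd e + z"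
  shows "2 * min (lev N v) (N - lev N z) \<le> \<bar>v - z\<bar> + \<bar>e - v\<bar>"
proof -
  obtain k where k: "e + z = 2 * N * k" using assms(2) by (auto elim: dvdE)
  then have k': "e + z = 2 * (N * k)" by simp
  show ?thesis
  proof (cases "even k")
    case True
    then obtain j where j: "k = 2 * j" by auto
    have "lev N v \<le> \<bar>v - N * k\<bar>" using lev_le_dist[OF assms(1), of v j] j by (simp add: mult.left_commute mult.assoc)
    then have "2 * lev N v \<le> \<bar>v - z\<bar> + \<bar>e - v\<bar>" using abs_midpoint(1)[OF k', of v] by (meson dual_order.trans mult_left_mono zero_le_numeral)
    then show ?thesis unfolding min_def by (simp split: if_splits)
  next
    case False
    then obtain j where j: "k = 2 * j + 1" by (auto elim: oddE)
    have "lev N (z + N) \<le> \<bar>z + N - 2 * N * (j + 1)\<bar>" by (rule lev_le_dist[OF assms(1)])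
    moreover have "z + N - 2 * N * (j + 1) = z - N * k" unfolding j by (simp add: algebra_simps)
    ultimately have "N - lev N z \<le> \<bar>z - N * k\<bar>" using lev_shift[OF assms(1)] by simp
    then have "2 * (N - lev N z) \<le> \<bar>v - z\<bar> + \<bar>e - v\<bar>" using abs_midpoint(2)[OF k', of v] by (meson dual_order.trans mult_left_mono zero_le_numeral)
    then show ?thesis unfolding min_def by (simp split: if_splits)
  qed
qed

text \<open>In doubled coordinates, the distance to the nearer end of the axis; equivalently, the
  number of carries on a shortest route to the mirror image, since each carry covers distance
  2.\<close>

definition circ_norm :: "int \<Rightarrow> int \<Rightarrow> int" where
  "circ_norm N z = min (z mod N) (N - z mod N)"

lemma circ_norm_lev: "circ_norm N z = min (lev N z) (N - lev N z)" if "N > 0"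
proof -
  define r where "r = z mod (2 * N)"
  have r: "0 \<le> r" "r < 2 * N" using that unfolding r_def by auto
  have e: "z mod N = r mod N" unfolding r_def by (simp add: mod_mod_cancel)
  show ?thesis
  proof (cases "r < N")
    case True
    then show ?thesis unfolding circ_norm_def lev_def e r_def[symmetric] using r by simp
  next
    case False
    have "r mod N = (r - N) mod N" by (rule minus_mod_self2[symmetric])
    also have "\<dots> = r - N" using False r by (intro mod_pos_pos_trivial) auto
    finally show ?thesis unfolding circ_norm_def lev_def e r_def[symmetric] using False r by linarith
  qed
qed

section \<open>Total length of the shortest routes\<close>

text \<open>The sum is \<open>f * f / 4\<close> rounded down. From \<open>g\<close> to
  \<open>g + 2\<close>, dropping the zero term and shifting the index raises every remaining minimum
  by one.\<close>

lemma sum_min_reflected: "int f * int f - 1 \<le> 4 * (\<Sum>x<f. min (int x) (int f - int x))"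
proof (induction f rule: nat_less_induct)
  case (1 f)
  consider "f = 0" | "f = 1" | g where "f = Suc (Suc g)" by (metis One_nat_def not0_implies_Suc)
  then show ?case
  proof cases
    case 3
    have "(\<Sum>x<f. min (int x) (int f - int x)) = (\<Sum>x<Suc g. min (int x + 1) (int g + 1 - int x))"
      unfolding 3 by (subst sum.lessThan_Suc_shift) (simp add: algebra_simps)
    also have "\<dots> = (\<Sum>x<Suc g. min (int x) (int g - int x) + 1)" by (rule sum.cong) auto
    also have "\<dots> = (\<Sum>x<g. min (int x) (int g - int x)) + int g + 1" by (simp add: sum.distrib)
    finally show ?thesis using 1[rule_format, of g] 3 by (simp add: algebra_simps)
  qed auto
qed

lemma sum_min_reflected_odd:
  "int f * int f \<le> 2 * (\<Sum>x<f. min (2 * int x + 1) (2 * int f - (2 * int x + 1)))"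
proof (induction f rule: nat_less_induct)
  case (1 f)
  consider "f = 0" | "f = 1" | g where "f = Suc (Suc g)" by (metis One_nat_def not0_implies_Suc)
  then show ?case
  proof cases
    case 3
    have "(\<Sum>x<f. min (2 * int x + 1) (2 * int f - (2 * int x + 1)))
        = 1 + (\<Sum>x<Suc g. min (2 * int x + 3) (2 * int g + 1 - 2 * int x))"
      unfolding 3 by (subst sum.lessThan_Suc_shift) (simp add: algebra_simps)
    also have "(\<Sum>x<Suc g. min (2 * int x + 3) (2 * int g + 1 - 2 * int x))
        = (\<Sum>x<Suc g. min (2 * int x + 1) (2 * int g - (2 * int x + 1)) + 2)"
      by (rule sum.cong) auto
    also have "\<dots> = (\<Sum>x<g. min (2 * int x + 1) (2 * int g - (2 * int x + 1))) + 2 * int g + 1"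
      by (simp add: sum.distrib)
    finally show ?thesis using 1[rule_format, of g] 3 by (simp add: algebra_simps)
  qed auto
qed

lemma sum_int_interval: "(\<Sum>b\<in>{0..<int f}. F b) = (\<Sum>x<f. F (int x))"
  by (rule sum.reindex_bij_witness[of _ int nat]) auto

lemma sum_shift_mod:
  fixes f d :: int and H :: "int \<Rightarrow> int"
  assumes "f > 0" and "coprime a f"
  shows "(\<Sum>b\<in>{0..<f}. H ((a * b - d) mod f)) = (\<Sum>b\<in>{0..<f}. H b)"
proof -
  have inj: "inj_on (\<lambda>b. (a * b - d) mod f) {0..<f}"
  proof (rule inj_onI)
    fix x y assume xy: "x \<in> {0..<f}" "y \<in> {0..<f}" "(a * x - d) mod f = (a * y - d) mod f"
    then have "f dvd a * (x - y)" by (simp add: mod_eq_dvd_iff algebra_simps)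
    then have "f dvd x - y" using assms(2) by (simp add: coprime_commute coprime_dvd_mult_right_iff)
    then have "x mod f = y mod f" by (simp add: mod_eq_dvd_iff)
    then show "x = y" using xy by simp
  qed
  have "(\<lambda>b. (a * b - d) mod f) ` {0..<f} = {0..<f}"
    by (rule endo_inj_surj) (use assms inj in auto)
  then show ?thesis using sum.reindex[OF inj, of H] by (simp add: o_def)
qed

text \<open>As 2 is invertible modulo an odd \<open>N\<close>, the values \<open>2 * b - d\<close>
  meet every residue once.\<close>

lemma sum_circ_norm_odd:
  assumes "odd N" and "N > 0"
  shows "N * N - 1 \<le> 4 * (\<Sum>b\<in>{0..<N}. circ_norm N (2 * b - d))"
proof -
  have "coprime 2 N" using assms by simp
  then have "(\<Sum>b\<in>{0..<N}. circ_norm N (2 * b - d)) = (\<Sum>b\<in>{0..<N}. min b (N - b))"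
    unfolding circ_norm_def using sum_shift_mod[of N 2 "\<lambda>r. min r (N - r)" d] assms by simp
  also have "\<dots> = (\<Sum>x<nat N. min (int x) (N - int x))"
    using sum_int_interval[of "\<lambda>b. min b (N - b)" "nat N"] assms by simp
  finally show ?thesis using sum_min_reflected[of "nat N"] assms by simp
qed

text \<open>For even \<open>N\<close> the values \<open>2 * b - d\<close> meet the residues of the
  parity of \<open>d\<close>, each twice. \<open>e\<close> is this parity, since odd residues give
  the slightly better bound.\<close>

lemma sum_circ_norm_even:
  assumes "N = 2 * f" and "f > 0" and "d = 2 * d' - e" and e: "e \<in> {0, 1}"
  shows "f * f - 1 + e \<le> (\<Sum>b\<in>{0..<N}. circ_norm N (2 * b - d))"
proof -
  define H where "H x = min (2 * x + e) (2 * f - (2 * x + e))" for x :: int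
  have c: "circ_norm N (2 * b - d) = H ((b - d') mod f)" for b
  proof -
    have m: "0 \<le> (b - d') mod f" "(b - d') mod f < f" using assms(2) by auto
    have "2 * b - d = 2 * ((b - d') mod f) + e + (2 * f) * ((b - d') div f)"
      unfolding assms(3) mult.assoc minus_mod_eq_mult_div[symmetric] by simp
    then have "(2 * b - d) mod (2 * f) = (2 * ((b - d') mod f) + e) mod (2 * f)"
      by (simp only: mod_mult_self2)
    also have "\<dots> = 2 * ((b - d') mod f) + e"
      using m e by (intro mod_pos_pos_trivial) auto
    finally show ?thesis unfolding circ_norm_def H_def assms(1) by simp
  qed
  have s: "(\<Sum>b\<in>{0..<f}. H ((b - d') mod f)) = (\<Sum>b\<in>{0..<f}. H b)"
    using sum_shift_mod[of f 1 H d'] assms(2) by simp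
  have "(\<Sum>b\<in>{f..<N}. H ((b - d') mod f)) = (\<Sum>b\<in>{0..<f}. H ((b - d') mod f))"
  proof (rule sum.reindex_bij_witness[of _ "\<lambda>b. b + f" "\<lambda>b. b - f"])
    fix b show "H ((b - f - d') mod f) = H ((b - d') mod f)"
      using minus_mod_self2[of "b - d'" f] by (simp add: algebra_simps)
  qed (simp_all add: assms(1))
  moreover have "{0..<N} = {0..<f} \<union> {f..<N}" using assms(1,2) by auto
  ultimately have "(\<Sum>b\<in>{0..<N}. circ_norm N (2 * b - d)) = 2 * (\<Sum>b\<in>{0..<f}. H b)"
    unfolding c by (subst \<open>{0..<N} = _\<close>) (subst sum.union_disjoint, auto simp: s)
  also have "(\<Sum>b\<in>{0..<f}. H b) = (\<Sum>x<nat f. H (int x))"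
    using sum_int_interval[of H "nat f"] assms(2) by simp
  finally have eq: "(\<Sum>b\<in>{0..<N}. circ_norm N (2 * b - d)) = 2 * (\<Sum>x<nat f. H (int x))" .
  show ?thesis
  proof (cases "e = 0")
    case True
    have "H x = 2 * min x (f - x)" for x unfolding H_def True min_def by auto
    then have "(\<Sum>x<nat f. H (int x)) = 2 * (\<Sum>x<nat f. min (int x) (f - int x))"
      by (simp add: sum_distrib_left)
    then show ?thesis using eq sum_min_reflected[of "nat f"] assms(2) True by simp
  next
    case False
    then show ?thesis using eq sum_min_reflected_odd[of "nat f"] assms(2) e unfolding H_def by simp
  qed
qed

section \<open>Lower bound for the reversal\<close>

text \<open>The condition \<open>final\<close> is what sorting the case \<open>i = 2\<close> means
  in terms of ranks.\<close>

locale walk =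
  fixes N :: int and mv :: "nat \<Rightarrow> int" and L :: nat
  assumes N_ge: "N \<ge> 3"
    and mv: "\<And>t. mv t \<in> {-1, 0, 1}"
    and final: "\<And>b. b \<in> {0..N} \<Longrightarrow> rank_at N mv L b = N - b"
begin

abbreviation rk :: "nat \<Rightarrow> int \<Rightarrow> int" where "rk \<equiv> rank_at N mv"

lemma rk_bij: "bij_betw (rk t) {0..N} {0..N}"
proof (induction t)
  case 0
  have "rk 0 = id" by auto
  then show ?case by (metis bij_betw_id)
next
  case (Suc t)
  define stp where "stp x = (if mv t = 0 then (if x = 0 then N else if x = N then 0 else x)
     else if mv t = 1 then (if x = 0 then N else x - 1) else (if x = N then 0 else x + 1))" for x
  have inj: "inj_on stp {0..N}" using N_ge by (auto simp: inj_on_def stp_def split: if_splits)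
  have "stp ` {0..N} \<subseteq> {0..N}" using N_ge by (auto simp: stp_def)
  then have "bij_betw stp {0..N} {0..N}" using inj by (simp add: bij_betw_def endo_inj_surj)
  moreover have "rk (Suc t) = stp \<circ> rk t" by (auto simp: stp_def Let_def)
  ultimately show ?case using bij_betw_trans[OF Suc] by metis
qed

lemma rk_range: "b \<in> {0..N} \<Longrightarrow> rk t b \<in> {0..N}"
  using rk_bij bij_betwE by blast

lemma rk_inj: "\<lbrakk>b \<in> {0..N}; b' \<in> {0..N}; rk t b = rk t b'\<rbrakk> \<Longrightarrow> b = b'"
  using rk_bij[of t] by (auto simp: bij_betw_def inj_on_def)

lemma rk_at: "\<exists>b\<in>{0..N}. rk t b = x \<and> (\<forall>b'\<in>{0..N}. rk t b' = x \<longrightarrow> b' = b)" if "x \<in> {0..N}"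
proof -
  have "x \<in> rk t ` {0..N}" using rk_bij[of t] that by (simp add: bij_betw_def)
  then obtain b where b: "b \<in> {0..N}" "rk t b = x" by blast
  then have "\<forall>b'\<in>{0..N}. rk t b' = x \<longrightarrow> b' = b" using rk_inj by metis
  then show ?thesis using b by blast
qed

section \<open>The robot and the items it carries\<close>

definition carried :: "nat \<Rightarrow> int \<Rightarrow> bool" where
  "carried t b \<longleftrightarrow> mv t = 1 \<and> rk t b = 0 \<or> mv t = -1 \<and> rk t b = N"

text \<open>
  Lifted positions of the items on the circle of \<open>N\<close> sites; the robot stands where ranks \<open>0\<close>
  and \<open>N\<close> are identified, and a move takes along the item that stays at the head.
\<close>

primrec item :: "nat \<Rightarrow> int \<Rightarrow> int" where
  "item 0 b = b"
| "item (Suc t) b = item t b + (if carried t b then mv t else 0)"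

definition robot :: "nat \<Rightarrow> int" where "robot t = (\<Sum>s<t. mv s)"

definition cost :: "nat \<Rightarrow> int \<Rightarrow> int" where "cost t b = (\<Sum>s<t. of_bool (carried s b))"

definition moves :: int where "moves = (\<Sum>s<L. \<bar>mv s\<bar>)"

definition swaps :: int where "swaps = (\<Sum>s<L. of_bool (mv s = 0))"

lemma moves_swaps: "moves + swaps = int L"
proof -
  have "moves + swaps = (\<Sum>s<L. \<bar>mv s\<bar> + of_bool (mv s = 0))"
    unfolding moves_def swaps_def by (simp only: sum.distrib)
  also have "\<dots> = (\<Sum>s<L. 1)" using mv by (intro sum.cong) force+
  finally show ?thesis by simp
qed

lemma ex1_carried: "\<exists>b\<in>{0..N}. \<forall>b'\<in>{0..N}. carried t b' \<longleftrightarrow> b' = b" if "mv t \<noteq> 0"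
proof (cases "mv t = 1")
  case True
  then show ?thesis using rk_at[of 0 t] N_ge unfolding carried_def by auto
next
  case False
  then have "mv t = -1" using mv[of t] that by auto
  then show ?thesis using rk_at[of N t] N_ge unfolding carried_def by auto
qed

lemma not_carried: "mv t = 0 \<Longrightarrow> \<not> carried t b"
  by (simp add: carried_def)

lemma sum_cost: "(\<Sum>b\<in>{0..N}. cost L b) = moves"
proof -
  have "(\<Sum>b\<in>{0..N}. of_bool (carried s b)) = \<bar>mv s\<bar>" for s
  proof (cases "mv s = 0")
    case False
    then obtain b where b: "b \<in> {0..N}" "\<And>b'. b' \<in> {0..N} \<Longrightarrow> carried s b' \<longleftrightarrow> b' = b"
      using ex1_carried by blast
    have "(\<Sum>b'\<in>{0..N}. of_bool (carried s b')) = (\<Sum>b'\<in>{0..N}. of_bool (b' = b))"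
      using b by (intro sum.cong) auto
    also have "\<dots> = (1 :: int)" using b(1) by (simp add: of_bool_def)
    finally show ?thesis using False mv[of s] by auto
  qed (simp add: not_carried)
  then show ?thesis unfolding cost_def moves_def by (subst sum.swap) simp
qed

text \<open>A swap exchanges the ranks \<open>0\<close> and \<open>N\<close>, which agree modulo
  \<open>N\<close>; hence only moves have to change the lifted positions.\<close>

lemma item_cong: "b \<in> {0..N} \<Longrightarrow> N dvd item t b - robot t - rk t b"
proof (induction t)
  case 0
  then show ?case by (simp add: robot_def)
next
  case (Suc t)
  have r: "robot (Suc t) = robot t + mv t" by (simp add: robot_def)
  obtain k where k: "item t b - robot t - rk t b = N * k" using Suc by (auto elim: dvdE)
  consider "mv t = 0" "rk t b = 0" | "mv t = 0" "rk t b = N" | "mv t = 0" "rk t b \<noteq> 0" "rk t b \<noteq> N"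
    | "mv t = 1" "rk t b = 0" | "mv t = 1" "rk t b \<noteq> 0" | "mv t = -1" "rk t b = N" | "mv t = -1" "rk t b \<noteq> N"
    using mv[of t] by auto
  then have "\<exists>j. item (Suc t) b - robot (Suc t) - rk (Suc t) b = N * k + N * j"
  proof cases
    case 1 then show ?thesis using k N_ge r by (intro exI[of _ "-1"]) (simp add: carried_def)
  next
    case 2 then show ?thesis using k N_ge r by (intro exI[of _ "1"]) (simp add: carried_def)
  next
    case 3 then show ?thesis using k N_ge r by (intro exI[of _ "0"]) (simp add: carried_def)
  next
    case 4 then show ?thesis using k N_ge r by (intro exI[of _ "-1"]) (simp add: carried_def)
  next
    case 5 then show ?thesis using k N_ge r by (intro exI[of _ "0"]) (simp add: carried_def)
  next
    case 6 then show ?thesis using k N_ge r by (intro exI[of _ "1"]) (simp add: carried_def)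
  next
    case 7 then show ?thesis using k N_ge r by (intro exI[of _ "0"]) (simp add: carried_def)
  qed
  then show ?case by (metis dvd_add dvd_triv_left)
qed

text \<open>Doubled coordinates relative to \<open>a\<close>, so that the axis \<open>a / 2\<close> becomes the origin.\<close>

definition pos :: "int \<Rightarrow> nat \<Rightarrow> int \<Rightarrow> int" where "pos a t b = 2 * item t b - a"

definition head :: "int \<Rightarrow> nat \<Rightarrow> int" where "head a t = 2 * robot t - a"

text \<open>The ranks \<open>0\<close> and \<open>N\<close> both mean the robot's own site, so a
  carried item travels together with the robot.\<close>

lemma lev_carried: "lev N (pos a t b) = lev N (head a t)" "lev N (pos a (Suc t) b) = lev N (head a (Suc t))"
  if "b \<in> {0..N}" "carried t b"
proof -
  have "N dvd item t b - robot t - rk t b" "N dvd rk t b" using item_cong[OF that(1)] that(2) by (auto simp: carried_def)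
  then have "N dvd (item t b - robot t - rk t b) + rk t b" by (rule dvd_add)
  then have "2 * N dvd 2 * (item t b - robot t)" by (intro mult_dvd_mono) auto
  then have d: "2 * N dvd 2 * item t b - 2 * robot t" by (simp only: right_diff_distrib)
  show "lev N (pos a t b) = lev N (head a t)" using d by (intro lev_cong) (simp add: pos_def head_def)
  show "lev N (pos a (Suc t) b) = lev N (head a (Suc t))" using d that(2)
    by (intro lev_cong) (simp add: pos_def head_def robot_def)
qed

text \<open>
  \<open>R\<close> is the largest level reached by the robot and \<open>v b\<close> a point of maximal level visited by item
  \<open>b\<close>.  When \<open>R\<close> grows, the carried item started at a level at most \<open>R\<close>, because items from higher
  levels are still untouched; hence the sum grows along with \<open>R\<close>.
\<close>

lemma level_invariant:
  "\<exists>R v. lev N (head a t) \<le> R \<and> lev N (head a 0) \<le> R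
    \<and> (\<forall>b\<in>{0..N}. \<bar>v b - pos a 0 b\<bar> + \<bar>pos a t b - v b\<bar> \<le> 2 * cost t b
         \<and> lev N (pos a 0 b) \<le> lev N (v b) \<and> lev N (pos a t b) \<le> lev N (v b)
         \<and> lev N (v b) \<le> max (lev N (pos a 0 b)) R
         \<and> (lev N (pos a 0 b) \<le> R \<or> pos a t b = pos a 0 b))
    \<and> min R U - min (lev N (head a 0)) U
        \<le> (\<Sum>b\<in>{0..N}. min (lev N (v b)) U - min (lev N (pos a 0 b)) U)"
proof (induction t)
  case 0
  show ?case
    by (rule exI[of _ "lev N (head a 0)"], rule exI[of _ "pos a 0"]) (auto simp: cost_def)
next
  case (Suc t)
  then obtain R v where R: "lev N (head a t) \<le> R" "lev N (head a 0) \<le> R"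
    and v: "\<And>b. b \<in> {0..N} \<Longrightarrow> \<bar>v b - pos a 0 b\<bar> + \<bar>pos a t b - v b\<bar> \<le> 2 * cost t b
         \<and> lev N (pos a 0 b) \<le> lev N (v b) \<and> lev N (pos a t b) \<le> lev N (v b)
         \<and> lev N (v b) \<le> max (lev N (pos a 0 b)) R
         \<and> (lev N (pos a 0 b) \<le> R \<or> pos a t b = pos a 0 b)"
    and sm: "min R U - min (lev N (head a 0)) U
        \<le> (\<Sum>b\<in>{0..N}. min (lev N (v b)) U - min (lev N (pos a 0 b)) U)"
    by blast
  have pS: "pos a (Suc t) b = (if carried t b then pos a t b + 2 * mv t else pos a t b)" for b
    by (simp add: pos_def)
  have cS: "cost (Suc t) b = cost t b + of_bool (carried t b)" for b
    by (simp add: cost_def)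
  show ?case
  proof (cases "mv t = 0")
    case True
    have "head a (Suc t) = head a t" by (simp add: head_def robot_def True)
    then show ?thesis using R v sm pS cS not_carried[OF True] by (intro exI[of _ R] exI[of _ v]) simp
  next
    case False
    then obtain c where c: "c \<in> {0..N}" and cc: "\<And>b. b \<in> {0..N} \<Longrightarrow> carried t b \<longleftrightarrow> b = c"
      using ex1_carried by blast
    define p where "p = pos a (Suc t) c"
    define R' where "R' = max R (lev N (head a (Suc t)))"
    \<comment> \<open>The record of the carried item is replaced only if the item is dragged beyond
      it.\<close>
    define v' where "v' = (if lev N p > lev N (v c) then v(c := p) else v)"
    have car: "carried t c" using c cc by blast
    have lp: "lev N p = lev N (head a (Suc t))" and lq: "lev N (pos a t c) = lev N (head a t)"
      unfolding p_def using lev_carried[OF c car] by auto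
    \<comment> \<open>Had \<open>c\<close> started above level \<open>R\<close>, it would still be
      at its starting place, whereas a carried item shares the robot's level, which is at most
      \<open>R\<close>.\<close>
    have zR: "lev N (pos a 0 c) \<le> R" using v[OF c] lq R by auto
    have ps: "\<bar>p - pos a t c\<bar> = 2" using pS[of c] car mv[of t] False by (auto simp: p_def)
    have v'_lev: "lev N (v' c) = max (lev N (v c)) (lev N p)" "\<And>b. b \<noteq> c \<Longrightarrow> v' b = v b"
      by (auto simp: v'_def)
    have vc: "\<bar>v' c - pos a 0 c\<bar> + \<bar>p - v' c\<bar> \<le> 2 * cost (Suc t) c"
    proof (cases "lev N p > lev N (v c)")
      case True
      have "\<bar>p - pos a 0 c\<bar> \<le> \<bar>p - pos a t c\<bar> + (\<bar>v c - pos a 0 c\<bar> + \<bar>pos a t c - v c\<bar>)" by arith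
      also have "\<dots> \<le> 2 + 2 * cost t c" using v[OF c] ps by linarith
      finally show ?thesis using True cS[of c] car by (simp add: v'_def)
    next
      case False
      have "\<bar>p - v c\<bar> \<le> \<bar>p - pos a t c\<bar> + \<bar>pos a t c - v c\<bar>" by arith
      then have "\<bar>v c - pos a 0 c\<bar> + \<bar>p - v c\<bar> \<le> 2 + 2 * cost t c" using v[OF c] ps by linarith
      then show ?thesis using False cS[of c] car by (simp add: v'_def)
    qed
    have "\<bar>v' b - pos a 0 b\<bar> + \<bar>pos a (Suc t) b - v' b\<bar> \<le> 2 * cost (Suc t) b
         \<and> lev N (pos a 0 b) \<le> lev N (v' b) \<and> lev N (pos a (Suc t) b) \<le> lev N (v' b)
         \<and> lev N (v' b) \<le> max (lev N (pos a 0 b)) R'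
         \<and> (lev N (pos a 0 b) \<le> R' \<or> pos a (Suc t) b = pos a 0 b)" if b: "b \<in> {0..N}" for b
    proof (cases "b = c")
      case True
      show ?thesis unfolding True p_def[symmetric] v'_lev(1) using vc v[OF c] zR lp
        by (auto simp: R'_def)
    next
      case False
      then have "\<not> carried t b" using cc b by blast
      then show ?thesis using v[OF b] pS[of b] cS[of b] v'_lev(2)[OF False] by (auto simp: R'_def)
    qed
    moreover have "min R' U - min (lev N (head a 0)) U
        \<le> (\<Sum>b\<in>{0..N}. min (lev N (v' b)) U - min (lev N (pos a 0 b)) U)"
    proof -
      have s: "(\<Sum>b\<in>{0..N}. g b) = g c + (\<Sum>b\<in>{0..N} - {c}. g b)" for g :: "int \<Rightarrow> int"
        using c by (simp add: sum.remove)
      have e: "(\<Sum>b\<in>{0..N} - {c}. min (lev N (v' b)) U - min (lev N (pos a 0 b)) U)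
          = (\<Sum>b\<in>{0..N} - {c}. min (lev N (v b)) U - min (lev N (pos a 0 b)) U)"
        by (rule sum.cong) (auto simp: v'_lev(2))
      \<comment> \<open>If \<open>R\<close> grows, its new value is the level of \<open>p\<close>,
        while the old record of \<open>c\<close> was at most \<open>R\<close>; the record of
        \<open>c\<close> therefore rises at least as much.\<close>
      have "min R' U - min R U \<le> min (lev N (v' c)) U - min (lev N (v c)) U"
        using v[OF c] zR lp unfolding v'_lev(1) R'_def by auto
      then show ?thesis using sm unfolding s e by linarith
    qed
    ultimately show ?thesis
      using R by (intro exI[of _ R'] exI[of _ v']) (auto simp: R'_def)
  qed
qed

section \<open>Lower bound for the number of moves\<close>

lemma even_moves_robot: "even (moves - robot L)"
proof -
  have "moves - robot L = (\<Sum>s<L. \<bar>mv s\<bar> - mv s)" unfolding moves_def robot_def by (simp only: sum_subtractf)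
  also have "even \<dots>" using mv by (intro dvd_sum) force
  finally show ?thesis .
qed

text \<open>
  The axis may be replaced by its antipode, so the robot can be assumed to start at level at most
  \<open>N / 2\<close>.  For \<open>N = 3\<close> and odd \<open>a\<close> all items above level 1 are at level \<open>N\<close>, hence already in place.
\<close>

lemma moves_ge_aux:
  assumes f: "2 * f = N \<or> 2 * f = N + 1"
  shows "\<exists>a. (a = robot L \<or> a = robot L + N) \<and>
    (if N = 3 \<and> odd a then 1 else f) + (\<Sum>b\<in>{0..<N}. circ_norm N (2 * b - a)) \<le> moves"
proof -
  have N: "N > 0" using N_ge by simp
  have "\<exists>a. (a = robot L \<or> a = robot L + N) \<and> 2 * lev N (- a) \<le> N"
  proof (cases "2 * lev N (- robot L) \<le> N")
    case False
    have "lev N (- (robot L + N)) = lev N (- robot L + N)" by (rule lev_cong) simp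
    also have "\<dots> = N - lev N (- robot L)" by (rule lev_shift[OF N])
    finally show ?thesis using False by (intro exI[of _ "robot L + N"]) auto
  qed blast
  then obtain a where a: "a = robot L \<or> a = robot L + N" "2 * lev N (- a) \<le> N" by blast
  have h0: "head a 0 = - a" by (simp add: head_def robot_def)
  have p0: "pos a 0 b = 2 * b - a" for b by (simp add: pos_def)
  define l0 where "l0 = lev N (- a)"
  obtain R v where R: "l0 \<le> R"
    and v: "\<And>b. b \<in> {0..N} \<Longrightarrow> \<bar>v b - pos a 0 b\<bar> + \<bar>pos a L b - v b\<bar> \<le> 2 * cost L b
         \<and> lev N (pos a 0 b) \<le> lev N (v b)
         \<and> (lev N (pos a 0 b) \<le> R \<or> pos a L b = pos a 0 b)"
    and sm: "min R f - min l0 f \<le> (\<Sum>b\<in>{0..N}. min (lev N (v b)) f - min (lev N (pos a 0 b)) f)"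
    using level_invariant[of a L f] unfolding h0 l0_def by blast
  have l0: "0 \<le> l0" "2 * l0 \<le> N" "l0 \<le> f" using a(2) f lev_bounds[OF N] unfolding l0_def by auto
  \<comment> \<open>Ending at \<open>robot L - b\<close> modulo \<open>N\<close> is reflection about
    half of \<open>robot L\<close>; adding \<open>N\<close> to \<open>a\<close> only exchanges the
    two ends of the axis.\<close>
  have refl: "2 * N dvd pos a L b + pos a 0 b" if b: "b \<in> {0..N}" for b
  proof -
    have "N dvd item L b - robot L - (N - b)" using item_cong[OF b, of L] final[OF b] by simp
    then have "2 * N dvd 2 * (item L b - robot L - (N - b))" by (intro mult_dvd_mono) auto
    moreover have "2 * N dvd 2 * robot L + 2 * N - 2 * a" using a(1) by auto
    ultimately have "2 * N dvd 2 * (item L b - robot L - (N - b)) + (2 * robot L + 2 * N - 2 * a)" by (rule dvd_add)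
    then show ?thesis by (simp add: pos_def algebra_simps)
  qed
  \<comment> \<open>The cap \<open>f\<close> is half of \<open>N\<close>, rounded up. An item
    starting at level at most \<open>N / 2\<close> has the alternative cost \<open>N - lev\<close>
    at least \<open>f\<close>, so it pays for every level gained up to the cap; an item starting
    higher is already at the cap and gains nothing.\<close>
  have c: "circ_norm N (2 * b - a) + (min (lev N (v b)) f - min (lev N (pos a 0 b)) f) \<le> cost L b"
    if b: "b \<in> {0..N}" for b
  proof -
    have "min (lev N (v b)) (N - lev N (pos a 0 b)) \<le> cost L b"
      using order_trans[OF reflected_path_length[OF N refl[OF b], of "v b"]] v[OF b]
        mult_le_cancel_left_pos[of 2] by force
    then show ?thesis using v[OF b] f unfolding circ_norm_lev[OF N] p0 by (auto simp: min_def split: if_splits)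
  qed
  have "(\<Sum>b\<in>{0..N}. circ_norm N (2 * b - a)) + (min R f - min l0 f) \<le> moves"
  proof -
    have "(\<Sum>b\<in>{0..N}. circ_norm N (2 * b - a) + (min (lev N (v b)) f - min (lev N (pos a 0 b)) f))
        \<le> (\<Sum>b\<in>{0..N}. cost L b)" using c by (rule sum_mono)
    then show ?thesis using sm unfolding sum_cost sum.distrib by linarith
  qed
  \<comment> \<open>Items \<open>0\<close> and \<open>N\<close> both start at the robot's site. The
    duplicate contributes \<open>l0\<close>, which cancels the subtracted
    \<open>min l0 f\<close>.\<close>
  moreover have "(\<Sum>b\<in>{0..N}. circ_norm N (2 * b - a)) = (\<Sum>b\<in>{0..<N}. circ_norm N (2 * b - a)) + l0"
  proof -
    have "{0..N} = insert N {0..<N}" using N by auto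
    moreover have "circ_norm N (2 * N - a) = l0"
    proof -
      have "lev N (2 * N - a) = l0" unfolding l0_def by (rule lev_cong) simp
      then show ?thesis using l0 unfolding circ_norm_lev[OF N] by simp
    qed
    ultimately show ?thesis by simp
  qed
  ultimately have m: "(\<Sum>b\<in>{0..<N}. circ_norm N (2 * b - a)) + min R f \<le> moves" using l0 by simp
  have "(if N = 3 \<and> odd a then 1 else f) \<le> min R f"
  proof (cases "N = 3 \<and> odd a")
    case True
    \<comment> \<open>An odd coordinate modulo 6 has nonzero level, so the robot starts at level at
      least 1.\<close>
    then have "odd ((- a) mod 6)" by presburger
    then have "l0 \<noteq> 0" using True unfolding l0_def lev_def by (auto simp: min_def split: if_splits)
    then show ?thesis using True R l0 f by auto
  next
    case False
    \<comment> \<open>Starting levels have the parity of \<open>a\<close>, so \<open>T\<close> is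
      the least one at or above \<open>f\<close>. It stays below \<open>N\<close> because the
      exceptional case is excluded.\<close>
    define T where "T = (if even (a + f) then f else f + 1)"
    have T: "f \<le> T" "0 < T" "T < N" "even (a + T)"
    proof -
      show "f \<le> T" by (simp add: T_def)
      show "0 < T" using f N_ge by (auto simp: T_def)
      show "even (a + T)" by (auto simp: T_def)
      show "T < N"
      proof (cases "N = 3")
        case True
        then have "f = 2" using f by auto
        then show ?thesis using False True by (auto simp: T_def)
      qed (use f N_ge in \<open>auto simp: T_def\<close>)
    qed
    \<comment> \<open>The item that starts at level \<open>T\<close>.\<close>
    define b where "b = ((a + T) div 2) mod N"
    have b: "b \<in> {0..N}" unfolding b_def using N by (auto intro: less_imp_le)
    have "N dvd b - (a + T) div 2" unfolding b_def by (metis mod_eq_dvd_iff mod_mod_trivial)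
    then have "2 * N dvd 2 * (b - (a + T) div 2)" by (intro mult_dvd_mono) auto
    then have "2 * N dvd pos a 0 b - T" using T(4) by (simp add: p0 right_diff_distrib diff_diff_eq)
    then have "lev N (pos a 0 b) = lev N T" by (rule lev_cong)
    also have "\<dots> = T" using T by (simp add: lev_def)
    finally have lT: "lev N (pos a 0 b) = T" .
    \<comment> \<open>Strictly between the ends of the axis no item is its own mirror image, so
      \<open>b\<close> must be touched and the robot must reach level \<open>T\<close>.\<close>
    have "T \<le> R"
    proof (rule ccontr)
      assume "\<not> T \<le> R"
      then have "pos a L b = pos a 0 b" using v[OF b] lT by simp
      then have "2 * N dvd 2 * pos a 0 b" using refl[OF b] by simp
      then have "N dvd pos a 0 b" by simp
      then have "circ_norm N (pos a 0 b) = 0" using N by (simp add: circ_norm_def)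
      then show False using lT T unfolding circ_norm_lev[OF N] by simp
    qed
    then show ?thesis using T False by auto
  qed
  then show ?thesis using a(1) m by (intro exI[of _ a]) linarith
qed

text \<open>Shortest routes give \<open>f * f - f\<close> and the dragging adds \<open>f\<close>;
  for \<open>N = 3\<close> the dragging may add only 1.\<close>

lemma moves_ge_odd: "2 * f = N + 1 \<Longrightarrow> (if N = 3 then 3 else f * f) \<le> moves"
proof -
  assume f: "2 * f = N + 1"
  obtain a where a: "(if N = 3 \<and> odd a then 1 else f) + (\<Sum>b\<in>{0..<N}. circ_norm N (2 * b - a)) \<le> moves"
    using moves_ge_aux f by blast
  have N: "N = 2 * f - 1" using f by simp
  have "N * N - 1 = 4 * (f * f - f)" unfolding N by (simp add: algebra_simps)
  moreover have "odd N" using f by presburger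
  ultimately have "f * f - f \<le> (\<Sum>b\<in>{0..<N}. circ_norm N (2 * b - a))"
    using sum_circ_norm_odd[of N a] N_ge by simp
  moreover have "N = 3 \<Longrightarrow> f = 2" using f by simp
  ultimately show ?thesis using a by (auto split: if_splits)
qed

text \<open>Routes and dragging give \<open>f * f + f - 1 + e\<close>. If \<open>e = 0\<close>, the
  missing unit comes from parity: for even \<open>N\<close> the numbers \<open>moves\<close>,
  \<open>robot L\<close> and \<open>a\<close> agree modulo 2, and \<open>f * f + f\<close> is
  even.\<close>

lemma moves_ge_even: "2 * f = N \<Longrightarrow> f * f + f \<le> moves"
proof -
  assume f: "2 * f = N"
  obtain a where a: "a = robot L \<or> a = robot L + N"
    "(if N = 3 \<and> odd a then 1 else f) + (\<Sum>b\<in>{0..<N}. circ_norm N (2 * b - a)) \<le> moves"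
    using moves_ge_aux f by blast
  define e where "e = a mod 2"
  have "N \<noteq> 3" using f by presburger
  have e: "e \<in> {0, 1}" unfolding e_def by auto
  have d: "a = 2 * ((a + e) div 2) - e" unfolding e_def by presburger
  have "f * f - 1 + e \<le> (\<Sum>b\<in>{0..<N}. circ_norm N (2 * b - a))"
    using sum_circ_norm_even[OF f[symmetric] _ d e] f N_ge by simp
  then have m: "f * f + f - 1 + e \<le> moves" using a(2) \<open>N \<noteq> 3\<close> by simp
  have "even (moves - a)" using a(1) even_moves_robot f by auto
  then have "e = 0 \<Longrightarrow> even moves" unfolding e_def by presburger
  moreover have "even (f * f + f)" by simp
  ultimately have "e = 0 \<Longrightarrow> moves \<noteq> f * f + f - 1" by auto
  then show ?thesis using m e by auto
qed

section \<open>Lower bound for the number of swaps\<close>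

definition swapped :: "int \<Rightarrow> int \<Rightarrow> nat \<Rightarrow> bool" where
  "swapped x y t \<longleftrightarrow> mv t = 0 \<and> (rk t x = 0 \<and> rk t y = N \<or> rk t x = N \<and> rk t y = 0)"

definition wraps :: "int \<Rightarrow> nat \<Rightarrow> bool" where
  "wraps x t \<longleftrightarrow> carried t x \<or> mv t = 0 \<and> rk t x \<in> {0, N}"

definition swap_count :: "int \<Rightarrow> int \<Rightarrow> nat \<Rightarrow> int" where
  "swap_count x y t = (\<Sum>s<t. of_bool (swapped x y s))"

definition wrap_count :: "int \<Rightarrow> nat \<Rightarrow> int" where
  "wrap_count x t = (\<Sum>s<t. of_bool (wraps x s))"

text \<open>Two items change their order if one of them alone jumps between the end ranks, or if
  they are swapped with each other. In the latter case both jump, and the swap makes the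
  contribution odd again.\<close>

lemma order_parity:
  assumes x: "x \<in> {0..N}" and y: "y \<in> {0..N}" and "x \<noteq> y"
  shows "rk t x > rk t y \<longleftrightarrow> (x > y \<longleftrightarrow> even (swap_count x y t + wrap_count x t + wrap_count y t))"
proof (induction t)
  case 0
  then show ?case by (simp add: swap_count_def wrap_count_def)
next
  case (Suc t)
  have r: "rk t x \<noteq> rk t y" "rk t x \<in> {0..N}" "rk t y \<in> {0..N}"
    using rk_inj[OF x y] rk_range[OF x] rk_range[OF y] assms(3) by blast+
  have "(rk (Suc t) x > rk (Suc t) y) = (rk t x > rk t y) \<longleftrightarrow>
      even (of_bool (swapped x y t) + of_bool (wraps x t) + of_bool (wraps y t) :: int)"
    using mv[of t] r N_ge by (auto simp: swapped_def wraps_def carried_def Let_def)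
  moreover have "swap_count x y (Suc t) + wrap_count x (Suc t) + wrap_count y (Suc t)
      = (swap_count x y t + wrap_count x t + wrap_count y t)
        + (of_bool (swapped x y t) + of_bool (wraps x t) + of_bool (wraps y t))"
    by (simp add: swap_count_def wrap_count_def)
  ultimately show ?case using Suc by (simp only: even_add) blast
qed

lemma odd_swap_wrap:
  assumes x: "x \<in> {0..N}" and y: "y \<in> {0..N}" and "x \<noteq> y"
  shows "odd (swap_count x y L + wrap_count x L + wrap_count y L)"
  using order_parity[OF assms, of L] final[OF x] final[OF y] assms(3) by auto

lemma swap_ends: "\<exists>p\<in>{0..N}. \<exists>q\<in>{0..N}. p \<noteq> q \<and>
    (\<forall>x\<in>{0..N}. (rk t x = 0 \<longleftrightarrow> x = p) \<and> (rk t x = N \<longleftrightarrow> x = q))"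
proof -
  obtain p where p: "p \<in> {0..N}" "rk t p = 0" using rk_at[of 0 t] N_ge by auto
  obtain q where q: "q \<in> {0..N}" "rk t q = N" using rk_at[of N t] N_ge by auto
  have "p \<noteq> q" using p q N_ge by auto
  then show ?thesis using p q rk_inj[of _ p t] rk_inj[of _ q t] by metis
qed

lemma sum_swap_count: "(\<Sum>x\<in>{0..N}. \<Sum>y\<in>{0..N}. swap_count x y L) = 2 * swaps"
proof -
  have "(\<Sum>x\<in>{0..N}. \<Sum>y\<in>{0..N}. of_bool (swapped x y s)) = (2 * of_bool (mv s = 0) :: int)" for s
  proof (cases "mv s = 0")
    case True
    obtain p q where pq: "p \<in> {0..N}" "q \<in> {0..N}" "p \<noteq> q"
      "\<And>x. x \<in> {0..N} \<Longrightarrow> (rk s x = 0 \<longleftrightarrow> x = p) \<and> (rk s x = N \<longleftrightarrow> x = q)"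
      using swap_ends[of s] by blast
    have "(\<Sum>x\<in>{0..N}. \<Sum>y\<in>{0..N}. of_bool (swapped x y s))
        = (\<Sum>x\<in>{0..N}. \<Sum>y\<in>{0..N}. of_bool (x = p) * of_bool (y = q) + of_bool (x = q) * of_bool (y = p) :: int)"
      using pq by (intro sum.cong refl) (auto simp: swapped_def True)
    also have "\<dots> = 2"
      using pq by (simp add: sum.distrib sum_distrib_left[symmetric] of_bool_def)
    finally show ?thesis using True by simp
  qed (simp add: swapped_def)
  then have "(\<Sum>s<L. \<Sum>x\<in>{0..N}. \<Sum>y\<in>{0..N}. of_bool (swapped x y s)) = 2 * swaps"
    unfolding swaps_def by (simp add: sum_distrib_left)
  moreover have "(\<Sum>x\<in>{0..N}. \<Sum>y\<in>{0..N}. swap_count x y L)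
      = (\<Sum>s<L. \<Sum>x\<in>{0..N}. \<Sum>y\<in>{0..N}. of_bool (swapped x y s))"
  proof -
    have "(\<Sum>y\<in>{0..N}. swap_count x y L) = (\<Sum>s<L. \<Sum>y\<in>{0..N}. of_bool (swapped x y s))" for x
      unfolding swap_count_def by (rule sum.swap)
    then show ?thesis by (simp only:) (rule sum.swap)
  qed
  ultimately show ?thesis by simp
qed

lemma sum_wrap_count: "(\<Sum>x\<in>{0..N}. wrap_count x L) = 2 * swaps + moves"
proof -
  have "wrap_count x L = cost L x + (\<Sum>s<L. of_bool (mv s = 0 \<and> rk s x \<in> {0, N}))" for x
    unfolding wrap_count_def cost_def sum.distrib[symmetric]
    by (rule sum.cong) (auto simp: wraps_def carried_def)
  moreover have "(\<Sum>x\<in>{0..N}. of_bool (mv s = 0 \<and> rk s x \<in> {0, N})) = (2 * of_bool (mv s = 0) :: int)" for s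
  proof -
    obtain p q where pq: "p \<in> {0..N}" "q \<in> {0..N}" "p \<noteq> q"
      "\<And>x. x \<in> {0..N} \<Longrightarrow> (rk s x = 0 \<longleftrightarrow> x = p) \<and> (rk s x = N \<longleftrightarrow> x = q)"
      using swap_ends[of s] by blast
    have "(\<Sum>x\<in>{0..N}. of_bool (mv s = 0 \<and> rk s x \<in> {0, N}))
        = (\<Sum>x\<in>{0..N}. of_bool (mv s = 0) * (of_bool (x = p) + of_bool (x = q)) :: int)"
      using pq by (intro sum.cong refl) auto
    also have "\<dots> = 2 * of_bool (mv s = 0)"
      using pq by (simp add: sum_distrib_left[symmetric] sum.distrib of_bool_def)
    finally show ?thesis .
  qed
  then have "(\<Sum>s<L. \<Sum>x\<in>{0..N}. of_bool (mv s = 0 \<and> rk s x \<in> {0, N})) = 2 * swaps"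
    unfolding swaps_def by (simp add: sum_distrib_left)
  ultimately show ?thesis using sum_cost
    by (simp only: sum.distrib sum.swap[of _ "{..<L}" "{0..N}"])
qed

text \<open>Two items whose wrap counts agree modulo 2 are swapped an odd number of times, hence at
  least once. Two classes of sizes \<open>a\<close> and \<open>b\<close> thus need
  \<open>a * (a - 1) + b * (b - 1)\<close> ordered swapped pairs, and the square of
  \<open>a - b\<close> is the excess over balanced classes.\<close>

lemma swaps_ge: "N * N - 1 \<le> 4 * swaps"
proof -
  define A where "A = {x \<in> {0..N}. even (wrap_count x L)}"
  define B where "B = {x \<in> {0..N}. odd (wrap_count x L)}"
  define a b where "a = int (card A)" and "b = int (card B)"
  have AB: "A \<union> B = {0..N}" "A \<inter> B = {}" by (auto simp: A_def B_def)
  have fin: "finite A" "finite B" using AB(1) by (metis finite_Un finite_atLeastAtMost_int)+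
  have ab: "a + b = N + 1"
    using card_Un_disjoint[OF fin AB(2)] N_ge unfolding AB(1) a_def b_def by simp
  have row: "(if x \<in> A then a else b) - 1 \<le> (\<Sum>y\<in>{0..N}. swap_count x y L)" if x: "x \<in> {0..N}" for x
  proof -
    define C where "C = (if x \<in> A then A else B)"
    have C: "x \<in> C" "finite C" "C \<subseteq> {0..N}" using AB fin x by (auto simp: C_def)
    have "(if x \<in> A then a else b) = int (card C)" by (simp add: C_def a_def b_def)
    then have "(if x \<in> A then a else b) - 1 = (\<Sum>y\<in>C - {x}. 1)"
      using card.remove[OF C(2,1)] by simp
    also have "\<dots> \<le> (\<Sum>y\<in>C - {x}. swap_count x y L)"
    proof (rule sum_mono)
      fix y assume y: "y \<in> C - {x}"
      then have "odd (swap_count x y L)"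
        using odd_swap_wrap[OF x, of y] C(3) x by (auto simp: C_def A_def B_def split: if_splits)
      moreover have "swap_count x y L \<ge> 0" unfolding swap_count_def by (rule sum_nonneg) simp
      ultimately show "1 \<le> swap_count x y L" by (cases "swap_count x y L = 0") auto
    qed
    also have "\<dots> \<le> (\<Sum>y\<in>{0..N}. swap_count x y L)"
      using C by (intro sum_mono2) (auto simp: swap_count_def intro: sum_nonneg)
    finally show ?thesis .
  qed
  have "(\<Sum>x\<in>{0..N}. (if x \<in> A then a else b) - 1) \<le> 2 * swaps"
    unfolding sum_swap_count[symmetric] using row by (rule sum_mono)
  moreover have "(\<Sum>x\<in>{0..N}. (if x \<in> A then a else b) - 1) = a * (a - 1) + b * (b - 1)"
  proof -
    have "(\<Sum>x\<in>B. (if x \<in> A then a else b) - 1) = (\<Sum>x\<in>B. b - 1)"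
      using AB(2) by (intro sum.cong) auto
    then show ?thesis unfolding AB(1)[symmetric] sum.union_disjoint[OF fin AB(2)] by (simp add: a_def b_def)
  qed
  ultimately have "2 * (a * (a - 1) + b * (b - 1)) \<le> 4 * swaps" by simp
  moreover have "2 * (a * (a - 1) + b * (b - 1)) = N * N - 1 + (a - b) * (a - b)"
  proof -
    have N: "N = a + b - 1" using ab by simp
    show ?thesis unfolding N by (simp add: algebra_simps)
  qed
  ultimately show ?thesis using zero_le_square[of "a - b"] by linarith
qed

text \<open>For \<open>n = 4\<close> the bound on the number of moves is one too small, and parity makes up for it.\<close>

lemma even_length_4: "even (moves + swaps)" if "N = 3"
proof -
  have I: "{0..N} = {0, 1, 2, 3}" using that by auto
  have sym: "swap_count x y L = swap_count y x L" for x y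
    unfolding swap_count_def swapped_def by (intro sum.cong) auto
  have z: "swap_count x x L = 0" for x
    using N_ge unfolding swap_count_def swapped_def by (intro sum.neutral) auto
  have sw: "swap_count 0 1 L + swap_count 0 2 L + swap_count 0 3 L + swap_count 1 2 L + swap_count 1 3 L
      + swap_count 2 3 L = swaps"
    using sum_swap_count unfolding I
    by (simp add: z sym[of 1 0] sym[of 2 0] sym[of 3 0] sym[of 2 1] sym[of 3 1] sym[of 3 2])
  have wr: "wrap_count 0 L + wrap_count 1 L + wrap_count 2 L + wrap_count 3 L = 2 * swaps + moves"
    using sum_wrap_count unfolding I by simp
  \<comment> \<open>The six pairs give six odd numbers with an even total, in which every wrap count
    occurs three times.\<close>
  have "odd (swap_count x y L + wrap_count x L + wrap_count y L)" if "x \<in> {0,1,2,3}" "y \<in> {0,1,2,3}" "x \<noteq> y" for x y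
    using odd_swap_wrap that unfolding I by blast
  from this[of 0 1] this[of 0 2] this[of 0 3] this[of 1 2] this[of 1 3] this[of 2 3]
  have "even ((swap_count 0 1 L + wrap_count 0 L + wrap_count 1 L)
    + (swap_count 0 2 L + wrap_count 0 L + wrap_count 2 L)
    + (swap_count 0 3 L + wrap_count 0 L + wrap_count 3 L)
    + (swap_count 1 2 L + wrap_count 1 L + wrap_count 2 L)
    + (swap_count 1 3 L + wrap_count 1 L + wrap_count 3 L)
    + (swap_count 2 3 L + wrap_count 2 L + wrap_count 3 L))" (is "even ?S")
    by (simp only: even_add) simp
  also have "?S = (swap_count 0 1 L + swap_count 0 2 L + swap_count 0 3 L + swap_count 1 2 L + swap_count 1 3 L
      + swap_count 2 3 L) + 3 * (wrap_count 0 L + wrap_count 1 L + wrap_count 2 L + wrap_count 3 L)" by simp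
  also have "\<dots> = swaps + 3 * (2 * swaps + moves)" unfolding sw wr ..
  finally show ?thesis by simp
qed

lemma length_ge: "N * (N + 1) \<le> 2 * int L"
proof (cases "even N")
  case True
  then obtain f where f: "2 * f = N" by (auto elim: evenE)
  have "4 * (f * f) - 1 \<le> 4 * swaps" using swaps_ge unfolding f[symmetric] by (simp add: algebra_simps)
  then have "f * f \<le> swaps" by simp
  then have "2 * (f * f) + f \<le> int L" using moves_ge_even[OF f] moves_swaps by linarith
  then show ?thesis unfolding f[symmetric] by (simp add: algebra_simps)
next
  case False
  then obtain f' where "N = 2 * f' + 1" by (auto elim: oddE)
  then have f: "2 * (f' + 1) = N + 1" by simp
  define f where "f = f' + 1"
  have f: "2 * f = N + 1" using f by (simp add: f_def)
  have N: "N = 2 * f - 1" using f by simp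
  have "4 * (f * f - f) \<le> 4 * swaps" using swaps_ge unfolding N by (simp add: algebra_simps)
  then have s: "f * f - f \<le> swaps" by simp
  show ?thesis
  proof (cases "N = 3")
    case True
    then have "f = 2" using f by simp
    \<comment> \<open>The separate bounds 3 and 2 give only 5, but the total is even.\<close>
    then have "6 \<le> moves + swaps"
      using True s moves_ge_odd[OF f] even_length_4 by simp presburger
    then show ?thesis using moves_swaps True by simp
  next
    case False
    then have "2 * (f * f) - f \<le> int L" using moves_ge_odd[OF f] s moves_swaps by simp
    then show ?thesis unfolding N by (simp add: algebra_simps)
  qed
qed

end

section \<open>Words in the generators\<close>

lemma perm_r_apply: "perm_r n k = (if 1 \<le> k \<and> k < n then k + 1 else if k = n then 1 else k)" if "n \<ge> 1"
  using that by (auto simp: perm_r_def one_line_def nth_append)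

lemma perm_s_apply: "perm_s n k = (if 1 \<le> k \<and> k \<le> n then n + 1 - k else k)"
  by (auto simp: perm_s_def one_line_def rev_nth simp del: upt_Suc)

definition unrotate :: "nat \<Rightarrow> nat \<Rightarrow> nat" where
  "unrotate n k = (if k = 1 then n else if 1 < k \<and> k \<le> n then k - 1 else k)"

lemma perm_r_unrotate: "perm_r n \<circ> unrotate n = id" "unrotate n \<circ> perm_r n = id" if "n \<ge> 1"
  using that by (auto simp: fun_eq_iff perm_r_apply unrotate_def)

lemma inv_perm_r: "inv (perm_r n) = unrotate n" if "n \<ge> 1"
  using perm_r_unrotate[OF that] by (intro inv_unique_comp)

lemma bij_permutes: "bij f \<Longrightarrow> (\<And>x. x \<notin> S \<Longrightarrow> f x = x) \<Longrightarrow> f permutes S"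
  unfolding permutes_def by (metis bij_pointE)

definition gens :: "nat \<Rightarrow> (nat \<Rightarrow> nat) set" where
  "gens n = {perm_delta, perm_r n, inv (perm_r n)}"

lemma gens_permutes: "x permutes {1..n}" if "x \<in> gens n" "n \<ge> 2"
proof -
  have n: "n \<ge> 1" using that by simp
  have "bij (perm_r n)" using perm_r_unrotate[OF n] by (metis o_bij)
  then have "perm_r n permutes {1..n}" using n by (intro bij_permutes) (auto simp: perm_r_apply)
  moreover have "perm_delta permutes {1..n}" unfolding perm_delta_def using that by (intro permutes_swap_id) auto
  ultimately show ?thesis using that(1) permutes_inv by (auto simp: gens_def)
qed

lemma gens_inv: "inv x \<in> gens n" if "x \<in> gens n" "n \<ge> 2"
proof -
  have "inv (inv x) = x" using gens_permutes[OF that] by (rule permutes_inv_inv)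
  moreover have "inv (inv (perm_r n)) = perm_r n"
    using gens_permutes[of "perm_r n" n] that(2) by (intro permutes_inv_inv) (auto simp: gens_def)
  moreover have "inv perm_delta = perm_delta" unfolding perm_delta_def by simp
  ultimately show ?thesis using that(1) by (auto simp: gens_def)
qed

text \<open>Edges are unordered; as the generators are closed under inverses, either orientation
  yields a generator.\<close>

lemma edge_iff:
  assumes n: "n \<ge> 2" and g: "g \<in> sym_perms n" and h: "h \<in> sym_perms n"
  shows "{g, h} \<in> cayley_edges n \<longleftrightarrow> (\<exists>x\<in>gens n. h = g \<circ> x)"
proof -
  have c: "h = g \<circ> x \<longleftrightarrow> inv g \<circ> h = x" if "g \<in> sym_perms n" for g h x :: "nat \<Rightarrow> nat"
  proof -
    have "g \<circ> inv g = id" "inv g \<circ> g = id" using that permutes_inv_o by (auto simp: sym_perms_def)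
    then show ?thesis by (metis comp_assoc id_comp)
  qed
  have sw: "\<exists>x\<in>gens n. h = g \<circ> x" if "g = h \<circ> x" "x \<in> gens n" for x
  proof -
    have "x \<circ> inv x = id" using gens_permutes[OF that(2) n] permutes_inv_o by auto
    then have "h = g \<circ> inv x" using that(1) by (simp add: comp_assoc)
    then show ?thesis using gens_inv[OF that(2) n] by blast
  qed
  show ?thesis
  proof
    assume "{g, h} \<in> cayley_edges n"
    then obtain g' h' where e: "{g, h} = {g', h'}" "g' \<in> sym_perms n" "inv g' \<circ> h' \<in> gens n"
      unfolding cayley_edges_def gens_def by blast
    then have "h' = g' \<circ> (inv g' \<circ> h')" using c by blast
    then show "\<exists>x\<in>gens n. h = g \<circ> x" using e sw by (metis doubleton_eq_iff)
  next
    assume "\<exists>x\<in>gens n. h = g \<circ> x"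
    then have "inv g \<circ> h \<in> gens n" using c[OF g] by auto
    then show "{g, h} \<in> cayley_edges n" using g h unfolding cayley_edges_def gens_def by blast
  qed
qed

text \<open>Sortable by a word of exactly \<open>L\<close> generators. Vertices may repeat, unlike
  on the paths that define the distance, so words can be extended freely.\<close>

primrec sortable :: "nat \<Rightarrow> nat \<Rightarrow> (nat \<Rightarrow> nat) set" where
  "sortable n 0 = {id}"
| "sortable n (Suc L) = {g. \<exists>x\<in>gens n. g \<circ> x \<in> sortable n L}"

lemma id_sortable: "id \<in> sortable n 0"
  by (simp only: sortable.simps singleton_iff)

lemma trivial_path: "u \<in> V \<Longrightarrow> path_between V E u [u] u"
  by (simp add: path_between_def)

lemma walk_sortable:
  assumes n: "n \<ge> 2"
  shows "\<lbrakk>p \<noteq> []; last p = id; set p \<subseteq> sym_perms n; successively (\<lambda>x y. {x, y} \<in> cayley_edges n) p\<rbrakk>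
    \<Longrightarrow> hd p \<in> sortable n (length p - 1)"
proof (induction p)
  case (Cons g p)
  show ?case
  proof (cases p)
    case (Cons h q)
    then have "{g, h} \<in> cayley_edges n" "h \<in> sortable n (length q)" using Cons.IH Cons.prems by auto
    then show ?thesis using edge_iff[OF n, of g h] Cons.prems Cons by auto
  next
    case Nil
    have "g = id" using Cons.prems(2) unfolding Nil last_ConsL[OF refl] .
    moreover have "length (g # p) - 1 = 0" unfolding Nil by simp
    ultimately show ?thesis using id_sortable by (simp only: list.sel)
  qed
qed simp

text \<open>If the new vertex already lies on the path, the path is cut there; hence only an upper
  bound on the length remains.\<close>

lemma sortable_path:
  assumes n: "n \<ge> 2"
  shows "\<lbrakk>g \<in> sym_perms n; g \<in> sortable n L\<rbrakk>
    \<Longrightarrow> \<exists>p. path_between (sym_perms n) (cayley_edges n) g p id \<and> length p \<le> Suc L"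
proof (induction L arbitrary: g)
  case 0
  have g: "g = id" using 0(2) by (simp only: sortable.simps singleton_iff)
  show ?case using trivial_path 0(1) unfolding g by fastforce
next
  case (Suc L)
  then obtain x where x: "x \<in> gens n" "g \<circ> x \<in> sortable n L" by auto
  have h: "g \<circ> x \<in> sym_perms n"
    using Suc.prems gens_permutes[OF x(1) n] by (auto simp: sym_perms_def intro: permutes_compose)
  obtain p where p: "path_between (sym_perms n) (cayley_edges n) (g \<circ> x) p id" "length p \<le> Suc L"
    using Suc.IH[OF h x(2)] by blast
  show ?case
  proof (cases "g \<in> set p")
    case True
    then obtain as bs where ab: "p = as @ g # bs" by (meson split_list)
    then have "path_between (sym_perms n) (cayley_edges n) g (g # bs) id"
      using p(1) by (auto simp: path_between_def successively_append_iff)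
    moreover have "length (g # bs) \<le> Suc (Suc L)" using p(2) ab by simp
    ultimately show ?thesis by blast
  next
    case False
    have "{g, g \<circ> x} \<in> cayley_edges n" using edge_iff[OF n Suc.prems(1) h] x(1) by blast
    then have "path_between (sym_perms n) (cayley_edges n) g (g # p) id"
      using p(1) False Suc.prems(1) by (auto simp: path_between_def successively_Cons)
    moreover have "length (g # p) \<le> Suc (Suc L)" using p(2) by simp
    ultimately show ?thesis by blast
  qed
qed

lemma cayley_dist_le:
  assumes "n \<ge> 2" "g \<in> sym_perms n" "g \<in> sortable n L"
  shows "cayley_dist n g id \<le> L"
proof -
  obtain p where "path_between (sym_perms n) (cayley_edges n) g p id" "length p \<le> Suc L"
    using sortable_path[OF assms] by blast
  then show ?thesis unfolding cayley_dist_def graph_dist_def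
    by (intro order_trans[OF Least_le]) auto
qed

text \<open>A sorting word provides a path, so the \<open>LEAST\<close> in the distance is attained
  and not an unspecified value.\<close>

lemma sortable_cayley_dist:
  assumes n: "n \<ge> 2" and "g \<in> sym_perms n" "g \<in> sortable n L"
  shows "g \<in> sortable n (cayley_dist n g id)"
proof -
  have "\<exists>k p. path_between (sym_perms n) (cayley_edges n) g p id \<and> k = length p - 1"
    using sortable_path[OF assms] by blast
  then have "\<exists>p. path_between (sym_perms n) (cayley_edges n) g p id \<and> cayley_dist n g id = length p - 1"
    unfolding cayley_dist_def graph_dist_def by (rule LeastI_ex)
  then show ?thesis using walk_sortable[OF n] by (auto simp: path_between_def)
qed

section \<open>From words to walks of ranks\<close>

definition position_rank :: "nat \<Rightarrow> nat \<Rightarrow> int" where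
  "position_rank n p = (if p = 1 then int n - 1 else int p - 2)"

text \<open>\<open>rank_at\<close> recurses on the last step, \<open>sortable\<close> on the first
  generator; this reconciles them.\<close>

lemma rank_at_Suc_shift: "rank_at N mv (Suc t) b = rank_at N (\<lambda>s. mv (Suc s)) t (rank_at N mv (Suc 0) b)"
  by (induction t) (simp_all add: Let_def)

text \<open>The entry \<open>g p\<close> starts at position \<open>p\<close> and, in the sorted
  list, stands at position \<open>g p\<close>.\<close>

lemma sortable_rank_at:
  assumes n: "n \<ge> 3"
  shows "g \<in> sortable n L \<Longrightarrow> \<exists>mv. (\<forall>t. mv t \<in> {-1, 0, 1}) \<and>
    (\<forall>p\<in>{1..n}. position_rank n (g p) = rank_at (int n - 1) mv L (position_rank n p))"
proof (induction L arbitrary: g)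
  case 0
  then show ?case by (intro exI[of _ "\<lambda>_. 0"]) auto
next
  case (Suc L)
  then obtain x where x: "x \<in> gens n" "g \<circ> x \<in> sortable n L" by auto
  obtain mv where mv: "\<forall>t. mv t \<in> {-1, 0, 1}"
    "\<And>p. p \<in> {1..n} \<Longrightarrow> position_rank n (g (x p)) = rank_at (int n - 1) mv L (position_rank n p)"
    using Suc.IH[OF x(2)] by auto
  \<comment> \<open>Right multiplication by \<open>x\<close> takes the entry at \<open>p\<close> to
    the position \<open>p'\<close> with \<open>x p' = p\<close>.\<close>
  have "\<exists>m\<in>{-1, 0, 1}. \<forall>p\<in>{1..n}. \<exists>p'\<in>{1..n}. x p' = p \<and>
      position_rank n p' = rank_at (int n - 1) (case_nat m mv) (Suc 0) (position_rank n p)"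
  proof -
    consider "x = perm_delta" | "x = perm_r n" | "x = unrotate n"
      using x(1) inv_perm_r[of n] n by (auto simp: gens_def)
    then show ?thesis
    proof cases
      case 1
      have "\<forall>p\<in>{1..n}. perm_delta p \<in> {1..n} \<and> x (perm_delta p) = p \<and>
        position_rank n (perm_delta p) = rank_at (int n - 1) (case_nat 0 mv) (Suc 0) (position_rank n p)"
        using n unfolding 1 by (auto simp: perm_delta_def position_rank_def transpose_def)
      then show ?thesis by blast
    next
      case 2
      have "\<forall>p\<in>{1..n}. unrotate n p \<in> {1..n} \<and> x (unrotate n p) = p \<and>
        position_rank n (unrotate n p) = rank_at (int n - 1) (case_nat 1 mv) (Suc 0) (position_rank n p)"
        using n unfolding 2 by (auto simp: unrotate_def perm_r_apply position_rank_def)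
      then show ?thesis by blast
    next
      case 3
      have "\<forall>p\<in>{1..n}. perm_r n p \<in> {1..n} \<and> x (perm_r n p) = p \<and>
        position_rank n (perm_r n p) = rank_at (int n - 1) (case_nat (-1) mv) (Suc 0) (position_rank n p)"
        using n unfolding 3 by (auto simp: unrotate_def perm_r_apply position_rank_def)
      then show ?thesis by blast
    qed
  qed
  then obtain m where m: "m \<in> {-1, 0, 1}" and
    step: "\<And>p. p \<in> {1..n} \<Longrightarrow> \<exists>p'\<in>{1..n}. x p' = p \<and>
      position_rank n p' = rank_at (int n - 1) (case_nat m mv) (Suc 0) (position_rank n p)"
    by blast
  have "position_rank n (g p) = rank_at (int n - 1) (case_nat m mv) (Suc L) (position_rank n p)"
    if p: "p \<in> {1..n}" for p
    unfolding rank_at_Suc_shift[where t = L] using step[OF p] mv(2) by fastforce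
  moreover have "\<forall>t. case_nat m mv t \<in> {-1, 0, 1}" using m mv(1) by (auto split: nat.split)
  ultimately show ?case by blast
qed

section \<open>Explicit form of the rotated reversals\<close>

abbreviation rotated_reversal :: "nat \<Rightarrow> nat \<Rightarrow> nat \<Rightarrow> nat" where
  "rotated_reversal n i \<equiv> perm_s n \<circ> (perm_r n ^^ (n - i))"

lemma perm_r_funpow: "(perm_r n ^^ m) k = (k - 1 + m) mod n + 1" if "1 \<le> k" "k \<le> n"
proof (induction m)
  case 0
  then show ?case using that by simp
next
  case (Suc m)
  define j where "j = (k - 1 + m) mod n"
  have j: "j < n" using that by (simp add: j_def)
  have "(perm_r n ^^ Suc m) k = perm_r n (j + 1)" using Suc by (simp add: j_def)
  also have "\<dots> = Suc j mod n + 1" using j by (auto simp: perm_r_apply mod_Suc)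
  also have "Suc j mod n = (k - 1 + Suc m) mod n" unfolding j_def by (simp add: mod_Suc_eq)
  finally show ?case .
qed

lemma rotated_reversal_apply:
  assumes "1 \<le> k" "k \<le> n" "i \<le> n"
  shows "rotated_reversal n i k = (if k \<le> i then i + 1 - k else n + i + 1 - k)"
proof -
  have "rotated_reversal n i k = n - (k - 1 + (n - i)) mod n"
    using assms perm_r_funpow[OF assms(1,2), of "n - i"] by (simp add: perm_s_apply Suc_le_eq)
  moreover have "(k - 1 + (n - i)) mod n = (if k \<le> i then k - 1 + (n - i) else k - 1 - i)"
  proof (cases "k \<le> i")
    case False
    then have "k - 1 + (n - i) = (k - 1 - i) + n" using assms by simp
    then have "(k - 1 + (n - i)) mod n = (k - 1 - i) mod n" by (simp only: mod_add_self2)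
    also have "\<dots> = k - 1 - i" using False assms by (intro mod_less) simp
    finally show ?thesis using False by (simp only: if_False)
  qed (use assms in auto)
  ultimately show ?thesis using assms by auto
qed

text \<open>The list 2, 1, n, ..., 3 sends rank \<open>b\<close> to rank \<open>n - 1 - b\<close>,
  so the bound for \<open>walk\<close> applies.\<close>

lemma length_ge_triangle:
  assumes n: "n \<ge> 4" and "rotated_reversal n 2 \<in> sortable n L"
  shows "n * (n - 1) \<le> 2 * L"
proof -
  obtain mv where mv: "\<And>t. mv t \<in> {-1, 0, 1}"
    "\<And>p. p \<in> {1..n} \<Longrightarrow> position_rank n (rotated_reversal n 2 p) = rank_at (int n - 1) mv L (position_rank n p)"
    using sortable_rank_at[OF _ assms(2)] n by fastforce
  have fin: "rank_at (int n - 1) mv L b = int n - 1 - b" if b: "b \<in> {0..int n - 1}" for b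
  proof -
    define p where "p = (if b = int n - 1 then 1 else nat b + 2)"
    have p: "p \<in> {1..n}" "position_rank n p = b" using b n by (auto simp: p_def position_rank_def)
    have "position_rank n (rotated_reversal n 2 p) = int n - 1 - b"
      using p n unfolding rotated_reversal_apply[of p n 2, simplified]
      by (subst rotated_reversal_apply) (auto simp: position_rank_def p_def split: if_splits)
    then show ?thesis using mv(2)[OF p(1)] p(2) by simp
  qed
  interpret walk "int n - 1" mv L using n mv(1) fin by unfold_locales auto
  have "int (n * (n - 1)) \<le> int (2 * L)" using length_ge n by (simp add: of_nat_diff algebra_simps)
  then show ?thesis by (simp only: of_nat_le_iff)
qed

section \<open>Sorting two arcs\<close>

text \<open>A right shift is expressed as a left shift in the other direction, which makes the
  relation visibly symmetric.\<close>

definition list_step :: "'a list \<Rightarrow> 'a list \<Rightarrow> bool" where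
  "list_step xs ys \<longleftrightarrow>
     (\<exists>x y zs. xs = x # y # zs \<and> ys = y # x # zs) \<or> ys = rotate1 xs \<or> xs = rotate1 ys"

lemma list_step_swap: "list_step (x # y # zs) (y # x # zs)"
  by (auto simp: list_step_def)

lemma list_step_left: "list_step (x # zs) (zs @ [x])"
  by (auto simp: list_step_def)

lemma list_step_sym: "list_step xs ys \<Longrightarrow> list_step ys xs"
  by (auto simp: list_step_def)

lemma list_walk_sym: "(list_step ^^ k) xs ys \<Longrightarrow> (list_step ^^ k) ys xs"
proof (induction k arbitrary: xs)
  case (Suc k)
  then obtain zs where "list_step xs zs" "(list_step ^^ k) zs ys" by (blast elim: relpowp_Suc_E2)
  then show ?case using Suc.IH list_step_sym by (blast intro: relpowp_Suc_I)
qed simp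

lemma list_walk_trans: "(list_step ^^ j) xs ys \<Longrightarrow> (list_step ^^ k) ys zs \<Longrightarrow> (list_step ^^ (j + k)) xs zs"
  by (auto simp: relpowp_add)

lemma list_step_length: "list_step xs ys \<Longrightarrow> length ys = length xs"
  by (auto simp: list_step_def)

text \<open>Reflection about the head; it exchanges left and right shifts.\<close>

fun mirror :: "'a list \<Rightarrow> 'a list" where
  "mirror (x # y # zs) = y # x # rev zs"
| "mirror xs = xs"

lemma mirror_rotate1:
  assumes "length xs \<ge> 2"
  shows "rotate1 (mirror (rotate1 xs)) = mirror xs"
proof -
  obtain x y zs where xs: "xs = x # y # zs" using assms by (cases xs rule: mirror.cases) auto
  show ?thesis by (cases zs) (simp_all add: xs)
qed

lemma list_step_mirror:
  assumes "list_step xs ys" "length xs \<ge> 2"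
  shows "list_step (mirror xs) (mirror ys)"
proof -
  have ly: "length ys \<ge> 2" using assms list_step_length by metis
  consider x y zs where "xs = x # y # zs" "ys = y # x # zs" | "ys = rotate1 xs" | "xs = rotate1 ys"
    using assms(1) unfolding list_step_def by blast
  then show ?thesis
  proof cases
    case 1
    then show ?thesis by (simp add: list_step_swap)
  next
    case 2
    then show ?thesis using mirror_rotate1[OF assms(2)] by (simp add: list_step_def)
  next
    case 3
    then show ?thesis using mirror_rotate1[OF ly] by (simp add: list_step_def)
  qed
qed

lemma list_walk_mirror:
  "(list_step ^^ k) xs ys \<Longrightarrow> length xs \<ge> 2 \<Longrightarrow> (list_step ^^ k) (mirror xs) (mirror ys)"
proof (induction k arbitrary: xs)
  case (Suc k)
  then obtain zs where z: "list_step xs zs" "(list_step ^^ k) zs ys" by (blast elim: relpowp_Suc_E2)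
  then have "(list_step ^^ k) (mirror zs) (mirror ys)" using Suc list_step_length by metis
  then show ?case using list_step_mirror[OF z(1) Suc.prems(2)] by (blast intro: relpowp_Suc_I2)
qed simp

text \<open>Swap \<open>x\<close> with its neighbour, then shift that neighbour to the back: two
  steps per entry.\<close>

lemma carry_right: "(list_step ^^ (2 * length vs)) (x # vs @ zs) (x # zs @ vs)"
proof (induction vs arbitrary: zs)
  case (Cons v vs)
  have "list_step (x # (v # vs) @ zs) (v # x # vs @ zs)" by (simp add: list_step_swap)
  moreover have "list_step (v # x # vs @ zs) (x # vs @ zs @ [v])" using list_step_left[of v "x # vs @ zs"] by simp
  moreover have "(list_step ^^ (2 * length vs)) (x # vs @ zs @ [v]) (x # zs @ v # vs)" using Cons[of "zs @ [v]"] by simp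
  ultimately have "(list_step ^^ Suc (Suc (2 * length vs))) (x # (v # vs) @ zs) (x # zs @ v # vs)"
    by (blast intro: relpowp_Suc_I2)
  then show ?case by simp
qed simp

lemma carry_left: "(list_step ^^ (2 * length vs)) (y # ws @ vs) (y # vs @ ws)"
  using carry_right[of vs y ws] by (rule list_walk_sym)

text \<open>\<open>x\<close> is carried over \<open>vs\<close> and swapped with \<open>y\<close>,
  \<open>y\<close> is carried back, one shift moves past \<open>y\<close>, and \<open>vs\<close> is
  treated recursively. Each layer takes \<open>4 * m + 2\<close> steps. Cyclically the arc becomes
  \<open>rev us\<close>, with the head in its middle; innermost arcs of two or three entries need no
  further shift.\<close>

lemma shaker:
  "length us \<ge> 2 \<Longrightarrow> (list_step ^^ (length us * length us - length us - 1)) (us @ zs)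
     (drop (length us div 2 - 1) (rev us) @ zs @ take (length us div 2 - 1) (rev us))"
proof (induction us arbitrary: zs rule: length_induct)
  case (1 us)
  obtain x us' where us': "us = x # us'" using 1(2) by (cases us) auto
  then have "us' \<noteq> []" using 1(2) by auto
  define vs y where "vs = butlast us'" and "y = last us'"
  have us: "us = x # vs @ [y]" unfolding vs_def y_def us' using \<open>us' \<noteq> []\<close> by simp
  define m where "m = length vs"
  have forward: "(list_step ^^ (2 * m + 1)) (us @ zs) (y # x # zs @ vs)"
  proof -
    have "(list_step ^^ (2 * m)) (us @ zs) (x # y # zs @ vs)"
      using carry_right[of vs x "y # zs"] by (simp add: us m_def)
    then show ?thesis using list_step_swap[of x y "zs @ vs"] by (auto intro: relpowp_Suc_I)
  qed
  have backward: "(list_step ^^ (2 * m)) (y # x # zs @ vs) (y # vs @ x # zs)"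
    using carry_left[of vs y "x # zs"] by (simp add: m_def)
  consider "m = 0" | "m = 1" | "m \<ge> 2" by linarith
  then show ?case
  proof cases
    case 1
    then show ?thesis using forward by (simp add: us m_def)
  next
    case 2
    then obtain v where v: "vs = [v]" unfolding m_def by (metis One_nat_def length_0_conv length_Suc_conv)
    have k: "length us * length us - length us - 1 = 2 * m + 1 + 2 * m" by (simp add: us v m_def)
    show ?thesis using list_walk_trans[OF forward backward] unfolding k by (simp add: us v del: relpowp.simps)
  next
    case 3
    have "list_step (y # vs @ x # zs) (vs @ (x # zs @ [y]))" using list_step_left[of y "vs @ x # zs"] by simp
    then have turn: "(list_step ^^ 1) (y # vs @ x # zs) (vs @ (x # zs @ [y]))" by (simp only: relpowp_1)
    have rec: "(list_step ^^ (m * m - m - 1)) (vs @ (x # zs @ [y]))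
      (drop (m div 2 - 1) (rev vs) @ (x # zs @ [y]) @ take (m div 2 - 1) (rev vs))"
      unfolding m_def by (rule 1(1)[rule_format]) (use 3 us m_def in simp_all)
    have g: "(m + 2) div 2 - 1 = Suc (m div 2 - 1)" "m div 2 - 1 \<le> length (rev vs)" using 3 by (auto simp: m_def)
    have len: "length us = m + 2" by (simp add: us m_def)
    have "m * m \<ge> 2 * m" using 3 by simp
    then have "m + 1 \<le> m * m" using 3 by linarith
    then obtain d where d: "m * m = m + 1 + d" using le_iff_add by blast
    have k: "2 * m + 1 + 2 * m + 1 + (m * m - m - 1) = length us * length us - length us - 1"
      unfolding len by (simp add: algebra_simps d)
    have fin: "drop (m div 2 - 1) (rev vs) @ (x # zs @ [y]) @ take (m div 2 - 1) (rev vs)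
        = drop (length us div 2 - 1) (rev us) @ zs @ take (length us div 2 - 1) (rev us)"
      unfolding len g(1) using g(2) by (simp add: us)
    show ?thesis using list_walk_trans[OF list_walk_trans[OF list_walk_trans[OF forward backward] turn] rec]
      unfolding k fin .
  qed
qed

text \<open>\<open>shaker\<close> on \<open>rev A\<close>, reflected and run backwards, leads from
  the middle of \<open>A\<close> to its end. Two shifts then bring \<open>rev B\<close> to the front
  for a second \<open>shaker\<close>. They also make up for the \<open>- 1\<close> in the length of
  each run.\<close>

lemma two_arcs:
  assumes "length A \<ge> 2" "length B \<ge> 2"
  defines "p \<equiv> length A" and "q \<equiv> length B"
  shows "(list_step ^^ (p * (p - 1) + q * (q - 1)))
    (mirror (drop (p div 2 - 1) A @ B @ take (p div 2 - 1) A))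
    (drop (q div 2 - 1) B @ A @ take (q div 2 - 1) B)"
proof -
  have "(list_step ^^ (p * p - p - 1)) (rev A @ B) (drop (p div 2 - 1) A @ B @ take (p div 2 - 1) A)"
    using shaker[of "rev A" B] assms(1) by (simp add: p_def)
  then have "(list_step ^^ (p * p - p - 1)) (mirror (rev A @ B)) (mirror (drop (p div 2 - 1) A @ B @ take (p div 2 - 1) A))"
    by (rule list_walk_mirror) (use assms(1) in simp)
  then have w1: "(list_step ^^ (p * p - p - 1)) (mirror (drop (p div 2 - 1) A @ B @ take (p div 2 - 1) A)) (mirror (rev A @ B))"
    by (rule list_walk_sym)
  obtain y x A' where A: "rev A = y # x # A'" using assms(1)
    by (metis Suc_le_length_iff length_rev numeral_2_eq_2)
  then have A2: "A = rev A' @ [x, y]" by (metis append.assoc append_Cons append_Nil rev.simps(2) rev_rev_ident)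
  have "list_step (x # y # rev B @ rev A') (y # rev B @ rev A' @ [x])"
    using list_step_left[of x "y # rev B @ rev A'"] by simp
  moreover have "list_step (y # rev B @ rev A' @ [x]) (rev B @ A)"
    using list_step_left[of y "rev B @ rev A' @ [x]"] by (simp add: A2)
  ultimately have "(list_step ^^ Suc (Suc 0)) (x # y # rev B @ rev A') (rev B @ A)"
    by (metis relpowp_Suc_I2 relpowp_0_I)
  then have w2: "(list_step ^^ 2) (mirror (rev A @ B)) (rev B @ A)"
    by (simp add: A numeral_2_eq_2)
  have w3: "(list_step ^^ (q * q - q - 1)) (rev B @ A) (drop (q div 2 - 1) B @ A @ take (q div 2 - 1) B)"
    using shaker[of "rev B" A] assms(2) by (simp add: q_def)
  have r: "Suc (r * r - r - 1) = r * (r - 1)" if "r \<ge> 2" for r :: nat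
  proof -
    have "r * (r - 1) \<ge> 1" using that by simp
    then show ?thesis by (simp add: diff_mult_distrib2)
  qed
  have "p * p - p - 1 + 2 + (q * q - q - 1) = p * (p - 1) + q * (q - 1)"
    using r[of p] r[of q] assms(1,2) unfolding p_def[symmetric] q_def[symmetric] by linarith
  then show ?thesis using list_walk_trans[OF list_walk_trans[OF w1 w2] w3] by simp
qed

section \<open>From list walks to sorting words\<close>

lemma one_line_step:
  assumes "list_step xs ys" and n: "length xs = n" "n \<ge> 2"
  shows "\<exists>x\<in>gens n. one_line ys = one_line xs \<circ> x"
proof -
  have rot: "one_line (rotate1 zs) = one_line zs \<circ> perm_r n" if "length zs = n" for zs
    using that n by (auto simp: fun_eq_iff one_line_def perm_r_apply nth_rotate1)
  consider x y zs where "xs = x # y # zs" "ys = y # x # zs" | "ys = rotate1 xs" | "xs = rotate1 ys"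
    using assms(1) unfolding list_step_def by blast
  then show ?thesis
  proof cases
    case 1
    have "one_line ys = one_line xs \<circ> perm_delta"
    proof
      fix k
      consider "k = 0" | "k = 1" | "k = 2" | j where "k = Suc (Suc (Suc j))"
        by (metis One_nat_def numeral_2_eq_2 old.nat.exhaust)
      then show "one_line ys k = (one_line xs \<circ> perm_delta) k"
        by cases (auto simp: 1 one_line_def perm_delta_def transpose_def)
    qed
    then show ?thesis by (auto simp: gens_def)
  next
    case 2
    then show ?thesis using rot n by (auto simp: gens_def)
  next
    case 3
    then have l: "length ys = n" using n by simp
    have "one_line xs \<circ> unrotate n = one_line ys \<circ> (perm_r n \<circ> unrotate n)"
      unfolding 3 rot[OF l] by (simp add: comp_assoc)
    then have "one_line ys = one_line xs \<circ> unrotate n" using perm_r_unrotate(1)[of n] n by simp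
    then show ?thesis using inv_perm_r[of n] n by (auto simp: gens_def)
  qed
qed

lemma list_walk_sortable:
  "(list_step ^^ k) xs ys \<Longrightarrow> one_line ys = id \<Longrightarrow> length xs = n \<Longrightarrow> n \<ge> 2 \<Longrightarrow> one_line xs \<in> sortable n k"
proof (induction k arbitrary: xs)
  case 0
  then show ?case using id_sortable by (metis relpowp_0_E)
next
  case (Suc k)
  then obtain zs where z: "list_step xs zs" "(list_step ^^ k) zs ys" by (blast elim: relpowp_Suc_E2)
  then have "one_line zs \<in> sortable n k" using Suc list_step_length by metis
  moreover obtain x where "x \<in> gens n" "one_line zs = one_line xs \<circ> x"
    using one_line_step[OF z(1) Suc.prems(3,4)] by blast
  ultimately show ?case by auto
qed

lemma one_line_upt: "one_line [1..<n + 1] = id"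
  by (auto simp: one_line_def fun_eq_iff simp del: upt_Suc)

lemma mirror_nth:
  assumes "length xs = n" "n \<ge> 2" "k < n"
  shows "mirror xs ! k = xs ! (if k < 2 then 1 - k else n + 1 - k)"
proof -
  obtain x y zs where xs: "xs = x # y # zs" using assms by (cases xs rule: mirror.cases) auto
  consider "k = 0" | "k = 1" | j where "k = Suc (Suc j)" by (metis One_nat_def old.nat.exhaust)
  then show ?thesis
  proof cases
    case 3
    then have "j < length zs" "n + 1 - k = Suc (Suc (length zs - Suc j))" using assms xs by auto
    then show ?thesis using 3 by (simp add: xs rev_nth)
  qed (simp_all add: xs)
qed

lemma length_mirror [simp]: "length (mirror xs) = length xs"
  by (cases xs rule: mirror.cases) auto

lemma sortable_rotated_reversal:
  assumes "p \<ge> 2" "q \<ge> 2"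
  shows "rotated_reversal (p + q) (q - q div 2 + p div 2 + 2) \<in> sortable (p + q) (p * (p - 1) + q * (q - 1))"
proof -
  \<comment> \<open>In the sorted list \<open>drop (g - 1) B\<close> comes first, so it must be
    \<open>[1..<a]\<close>; its length \<open>q - (g - 1)\<close> determines \<open>a\<close>. The
    first \<open>g' - 1\<close> entries of \<open>A\<close> then end at \<open>e\<close>, where the
    starting list is cut.\<close>
  define n g g' a e where "n = p + q" and "g = q div 2" and "g' = p div 2"
    and "a = q - g + 2" and "e = q - g + g'"
  define A where "A = [a..<a + p]"
  define B where "B = [a + p..<n + 1] @ [1..<a]"
  have b: "g \<ge> 1" "g' \<ge> 1" "2 * g \<le> q" "2 * g' \<le> p" using assms by (auto simp: g_def g'_def)
  have lA: "length A = p" by (simp add: A_def)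
  have "length B = (n + 1 - (a + p)) + (a - 1)" by (simp add: B_def del: upt_Suc)
  also have "\<dots> = q" using b unfolding a_def n_def by arith
  finally have lB: "length B = q" .
  have "n + 1 - (a + p) = g - 1" using b unfolding a_def n_def by arith
  then have gB: "length [a + p..<n + 1] = g - 1" by (simp del: upt_Suc)
  have e1: "drop (g - 1) B = [1..<a]" "take (g - 1) B = [a + p..<n + 1]"
    unfolding B_def using gB by (simp_all del: upt_Suc)
  have e2: "drop (g' - 1) A = [e + 1..<a + p]" "take (g' - 1) A = [a..<e + 1]"
  proof -
    have "a + (g' - 1) = e + 1" "a + (g' - 1) \<le> a + p" using b unfolding a_def e_def by arith+
    then show "drop (g' - 1) A = [e + 1..<a + p]" "take (g' - 1) A = [a..<e + 1]"
      unfolding A_def by (simp_all only: drop_upt take_upt)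
  qed
  have up: "[i..<j] @ [j..<k] = [i..<k]" if "i \<le> j" "j \<le> k" for i j k
    using that by (metis upt_add_eq_append le_add_diff_inverse)
  have stop: "drop (g - 1) B @ A @ take (g - 1) B = [1..<n + 1]"
  proof -
    have "1 \<le> a" "a \<le> a + p" "a + p \<le> n + 1" using b unfolding a_def n_def by arith+
    then show ?thesis unfolding e1 A_def by (metis up order_trans)
  qed
  have start: "drop (g' - 1) A @ B @ take (g' - 1) A = [e + 1..<n + 1] @ [1..<e + 1]" (is "_ = ?I")
  proof -
    have "[e + 1..<a + p] @ [a + p..<n + 1] = [e + 1..<n + 1]" "[1..<a] @ [a..<e + 1] = [1..<e + 1]"
    proof -
      have "e + 1 \<le> a + p" "a + p \<le> n + 1" "1 \<le> a" "a \<le> e + 1"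
        using b unfolding a_def e_def n_def by arith+
      then show "[e + 1..<a + p] @ [a + p..<n + 1] = [e + 1..<n + 1]" "[1..<a] @ [a..<e + 1] = [1..<e + 1]"
        using up by blast+
    qed
    then show ?thesis unfolding e2 B_def by (metis append.assoc)
  qed
  have "(list_step ^^ (p * (p - 1) + q * (q - 1))) (mirror ?I) [1..<n + 1]"
    using two_arcs[of A B] assms unfolding lA lB g_def[symmetric] g'_def[symmetric] stop start by blast
  moreover have len: "length ?I = n"
  proof -
    have "e \<le> n" using b unfolding e_def n_def by arith
    then show ?thesis by (simp del: upt_Suc)
  qed
  ultimately have "one_line (mirror ?I) \<in> sortable n (p * (p - 1) + q * (q - 1))"
    using one_line_upt[of n] assms by (intro list_walk_sortable) (auto simp: n_def)
  moreover have "one_line (mirror ?I) = rotated_reversal n (e + 2)"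
  proof
    fix k
    have en: "e + 2 \<le> n" "n \<ge> 2" using b unfolding e_def n_def by arith+
    show "one_line (mirror ?I) k = rotated_reversal n (e + 2) k"
    proof (cases "1 \<le> k \<and> k \<le> n")
      case True
      have "one_line (mirror ?I) k = ?I ! (if k - 1 < 2 then 1 - (k - 1) else n + 1 - (k - 1))"
      proof -
        have "k - 1 < n" using True by auto
        moreover have "one_line (mirror ?I) k = mirror ?I ! (k - 1)" using True len unfolding one_line_def by simp
        ultimately show ?thesis using mirror_nth[OF len en(2)] by metis
      qed
      also have "\<dots> = (if k \<le> e + 2 then e + 2 + 1 - k else n + (e + 2) + 1 - k)"
        using True en by (auto simp: nth_append simp del: upt_Suc)
      also have "\<dots> = rotated_reversal n (e + 2) k" using True en by (subst rotated_reversal_apply) auto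
      finally show ?thesis .
    next
      case False
      have "(perm_r n ^^ m) k = k" for m using False en by (induction m) (auto simp: perm_r_apply)
      then show ?thesis using False len by (auto simp: one_line_def perm_s_apply simp del: upt_Suc)
    qed
  qed
  ultimately show ?thesis by (simp add: n_def e_def g_def g'_def)
qed

section \<open>The distances\<close>

lemma rotated_reversal_sym_perms: "rotated_reversal n i \<in> sym_perms n" if "n \<ge> 2"
proof -
  have "perm_r n permutes {1..n}" using gens_permutes[OF _ that] by (simp add: gens_def)
  then have "(perm_r n ^^ m) permutes {1..n}" for m by (rule permutes_funpow)
  moreover have "perm_s n permutes {1..n}"
  proof (rule bij_permutes)
    have "perm_s n \<circ> perm_s n = id" by (auto simp: perm_s_apply fun_eq_iff)
    then show "bij (perm_s n)" by (metis o_bij)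
  qed (auto simp: perm_s_apply)
  ultimately show ?thesis by (auto simp: sym_perms_def intro: permutes_compose)
qed

lemma rotated_reversal_Suc:
  "i < n \<Longrightarrow> rotated_reversal n i = rotated_reversal n (Suc i) \<circ> perm_r n"
  by (metis Suc_diff_Suc comp_assoc funpow_Suc_right)

lemma rotated_reversal_0: "rotated_reversal n 0 = rotated_reversal n n" if "n \<ge> 1"
proof
  fix k
  show "rotated_reversal n 0 k = rotated_reversal n n k"
  proof (cases "1 \<le> k \<and> k \<le> n")
    case True
    then show ?thesis using rotated_reversal_apply[of k n 0] rotated_reversal_apply[of k n n] by simp
  next
    case False
    have "(perm_r n ^^ m) k = k" for m using False that by (induction m) (auto simp: perm_r_apply)
    then show ?thesis by simp
  qed
qed

lemma sortable_rotated_reversal_adjacent: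
  assumes "n \<ge> 2" "i < n"
  shows "rotated_reversal n (Suc i) \<in> sortable n L \<Longrightarrow> rotated_reversal n i \<in> sortable n (Suc L)"
    and "rotated_reversal n i \<in> sortable n L \<Longrightarrow> rotated_reversal n (Suc i) \<in> sortable n (Suc L)"
proof -
  have r: "perm_r n \<in> gens n" by (simp add: gens_def)
  have "perm_r n \<circ> inv (perm_r n) = id" using gens_permutes[OF r assms(1)] by (rule permutes_inv_o)
  then have "rotated_reversal n (Suc i) = rotated_reversal n i \<circ> inv (perm_r n)"
    unfolding rotated_reversal_Suc[OF assms(2)] by (metis comp_assoc comp_id)
  then show "rotated_reversal n (Suc i) \<in> sortable n L \<Longrightarrow> rotated_reversal n i \<in> sortable n (Suc L)"
    by (auto simp: gens_def)
  show "rotated_reversal n i \<in> sortable n L \<Longrightarrow> rotated_reversal n (Suc i) \<in> sortable n (Suc L)"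
    using rotated_reversal_Suc[OF assms(2)] r by auto
qed

theorem theorem1:
  fixes n i :: nat
  assumes "n \<ge> 4" and "i \<in> {1..n}"
  shows "let c = \<lceil>real n / 2\<rceil>; f = \<lfloor>real n / 2\<rfloor>;
             d = int (cayley_dist n (perm_s n \<circ> (perm_r n ^^ (n - i))) id);
             b = c * (c - 1) - 1 + f * (f - 1) - 1
         in (i = 1 \<longrightarrow> d = b + (f + 1)) \<and>
            (2 \<le> int i \<and> int i \<le> f + 2 \<longrightarrow> d = b + (f - int i + 4)) \<and>
            (c + 2 \<le> int i \<and> int i \<le> int n \<longrightarrow> d = b + (int i - c))"
proof -
  define f c where "f = n div 2" and "c = n - f"
  have fc: "f \<ge> 2" "c = f \<or> c = f + 1" "n = f + c" using assms(1) by (auto simp: f_def c_def)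
  have cr: "\<lceil>real n / 2\<rceil> = int c" "\<lfloor>real n / 2\<rfloor> = int f"
    using fc by (auto simp: ceiling_eq_iff floor_eq_iff)
  define d where "d j = int (cayley_dist n (rotated_reversal n j) id)" for j
  define w where "w = c * (c - 1) + f * (f - 1)"
  have near: "rotated_reversal n (f + 2) \<in> sortable n w" "rotated_reversal n (c + 2) \<in> sortable n w"
  proof -
    have split: "rotated_reversal n (q - q div 2 + p div 2 + 2) \<in> sortable n w"
      if "p = f \<and> q = c \<or> p = c \<and> q = f" for p q
      using sortable_rotated_reversal[of p q] that fc by (auto simp: w_def add.commute)
    have "f - f div 2 + f div 2 = f" by simp
    \<comment> \<open>The two assignments of the arc lengths \<open>f\<close> and \<open>c\<close>
      reach both minima; for odd \<open>n\<close> the parity of \<open>f\<close> decides which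
      reaches which.\<close>
    moreover have "Suc f - Suc f div 2 + f div 2 = f \<and> f - f div 2 + Suc f div 2 = Suc f
      \<or> Suc f - Suc f div 2 + f div 2 = Suc f \<and> f - f div 2 + Suc f div 2 = f"
      by (cases "even f") (auto elim!: evenE oddE)
    ultimately have "c - c div 2 + f div 2 = f \<and> f - f div 2 + c div 2 = c
      \<or> c - c div 2 + f div 2 = c \<and> f - f div 2 + c div 2 = f"
      using fc(2) by auto
    then show "rotated_reversal n (f + 2) \<in> sortable n w" "rotated_reversal n (c + 2) \<in> sortable n w"
      using split[of f c] split[of c f] by metis+
  qed
  have n: "n \<ge> 2" using assms by simp
  have le: "d j \<le> int L" if "rotated_reversal n j \<in> sortable n L" for j L
    using cayley_dist_le[OF n rotated_reversal_sym_perms[OF n] that] by (simp add: d_def)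
  have dist: "\<exists>L. d j = int L \<and> rotated_reversal n j \<in> sortable n L"
    if "\<exists>L. rotated_reversal n j \<in> sortable n L" for j
    using that sortable_cayley_dist[OF n rotated_reversal_sym_perms[OF n]] d_def by blast
  \<comment> \<open>Adjacency spreads sortability from the minimum at \<open>f + 2\<close> to every
    index, so all these distances are genuine.\<close>
  have reach: "\<exists>L. rotated_reversal n (f + 2 + k) \<in> sortable n L" if "f + 2 + k \<le> n" for k
    using that
  proof (induction k)
    case 0
    then show ?case using near(1) by (metis add_0_right)
  next
    case (Suc k)
    then show ?case using sortable_rotated_reversal_adjacent(2)[OF n, of "f + 2 + k"]
      by (metis Suc_leD Suc_le_eq add_Suc_right)
  qed
  have reach': "\<exists>L. rotated_reversal n (f + 2 - k) \<in> sortable n L" for k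
  proof (induction k)
    case 0
    then show ?case using near(1) by (metis diff_zero)
  next
    case (Suc k)
    show ?case
    proof (cases "k < f + 2")
      case True
      then have "f + 2 - k = Suc (f + 2 - Suc k)" "f + 2 - Suc k < n" using fc by auto
      then show ?thesis using sortable_rotated_reversal_adjacent(1)[OF n, of "f + 2 - Suc k"] Suc by metis
    next
      case False
      then have "f + 2 - Suc k = f + 2 - k" by simp
      then show ?thesis using Suc by metis
    qed
  qed
  have ex: "\<exists>L. rotated_reversal n j \<in> sortable n L" if "j \<le> n" for j
  proof (cases "f + 2 \<le> j")
    case True
    then show ?thesis using reach[of "j - (f + 2)"] that by (metis le_add_diff_inverse)
  next
    case False
    then show ?thesis using reach'[of "f + 2 - j"] by (metis diff_diff_cancel nat_le_linear)
  qed
  have lip: "\<bar>d (Suc j) - d j\<bar> \<le> 1" if j: "j < n" for j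
  proof -
    obtain L where L: "d j = int L" "rotated_reversal n j \<in> sortable n L" using dist[OF ex[OF less_imp_le[OF j]]] by blast
    obtain L' where L': "d (Suc j) = int L'" "rotated_reversal n (Suc j) \<in> sortable n L'" using dist[OF ex[OF Suc_leI[OF j]]] by blast
    show ?thesis
      using le[OF sortable_rotated_reversal_adjacent(1)[OF n j L'(2)]]
        le[OF sortable_rotated_reversal_adjacent(2)[OF n j L(2)]] L(1) L'(1) by simp
  qed
  have lips: "j + k \<le> n \<Longrightarrow> \<bar>d (j + k) - d j\<bar> \<le> int k" for j k
  proof (induction k)
    case (Suc k)
    then show ?case using lip[of "j + k"] by simp
  qed simp
  have lipschitz: "\<bar>d k - d j\<bar> \<le> int k - int j" if "j \<le> k" "k \<le> n" for j k
    using lips[of j "k - j"] that unfolding le_add_diff_inverse[OF that(1)] by (simp add: of_nat_diff)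
  \<comment> \<open>Closing the cycle of indices lets the index 1 be compared with
    \<open>n\<close>.\<close>
  have d0: "d 0 = d n" unfolding d_def using rotated_reversal_0[of n] n by simp
  have low: "2 * d 2 \<ge> int (n * (n - 1))"
  proof -
    obtain L where L: "d 2 = int L" "rotated_reversal n 2 \<in> sortable n L" using dist ex n by blast
    show ?thesis using length_ge_triangle[OF assms(1) L(2)] L(1) by linarith
  qed
  define b where "b = int c * (int c - 1) - 1 + int f * (int f - 1) - 1"
  have w: "int w = b + 2" using fc by (auto simp: w_def b_def of_nat_diff)
  have tri: "int (n * (n - 1)) = 2 * (b + 2 + int f)"
  proof -
    have "int (n * (n - 1)) = int n * (int n - 1)" using n by (simp add: of_nat_diff)
    also have "int n = int f + int c" using fc(3) by simp
    finally show ?thesis using fc(2) by (auto simp: b_def algebra_simps)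
  qed
  have up: "d (f + 2) \<le> b + 2" "d (c + 2) \<le> b + 2" using le[OF near(1)] le[OF near(2)] w by auto
  have d2: "d 2 \<ge> b + 2 + int f" using low tri by simp
  have bounds: "c + 2 \<le> n" "f + 2 \<le> n" using fc by auto
  have i: "1 \<le> i" "i \<le> n" using assms(2) by auto
  have around: "d 1 \<ge> d 2 - 1" "d 1 \<le> d n + 1"
    using lip[of 1] lip[of 0] n d0 by (auto simp: numeral_2_eq_2)
  \<comment> \<open>All three cases pinch \<open>d i\<close> between the lower bound at index 2 and
    an upper bound at a minimum. For \<open>i = 1\<close> and for \<open>i\<close> beyond
    \<open>c + 2\<close> the chain passes through the adjacent indices \<open>n\<close> and
    1.\<close>
  have c1: "d i = b + (int f + 1)" if "i = 1"
    using lipschitz[OF bounds(1)] up around d2 fc(3) that by simp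
  have c2: "d i = b + (int f - int i + 4)" if "2 \<le> i" "i \<le> f + 2"
    using lipschitz[of 2 i] lipschitz[of i "f + 2"] bounds that i d2 up by simp
  have c3: "d i = b + (int i - int c)" if "c + 2 \<le> i"
    using lipschitz[of "c + 2" i] lipschitz[of i n] that i d2 up around fc(3) by simp
  show ?thesis
    unfolding Let_def cr d_def[symmetric] b_def[symmetric] using c1 c2 c3 by auto
qed

end
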